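(* Let $\mathbb{F}_q$ be a finite field with $q$ elements, let $n>1$, $1\le d<n$ be integers, let $\alpha\in\mathbb{F}_{q^n}$ be a root of an irreducible polynomial of degree $n$ over $\mathbb{F}_q$, and let $0<\delta<1$. Assume $(n-1)\leq q^{d/2}(1-\delta)$. Then every non-trivial eigenvalue $\lambda$ of the weighted adjacency operator $M^*$ of the weighted graph $G_d^*(n,q,\alpha)$ satisfies $|\lambda|\leq \lambda_{triv}(1-\delta)$, where $\lambda_{triv}=q^d$. In particular, the weighted graph $G_d^*(n,q,\alpha)$ is an expander graph.
   Context: $\Gamma_f=\mathbb{F}_{q^n}^*$. A polynomial of positive degree is primary if it is a power of an irreducible polynomial. $P_d$ is the set of monic primary polynomials of degree $d$ in $\mathbb{F}_q[x]$; for $g\in P_d$, $\Lambda(g)$ is the degree of the unique irreducible factor of $g$. $H$ is the subgroup of $\Gamma_f$ generated by $\{g(\alpha):g\in P_d\}$. The weighted graph $G_d^*(n,q,\alpha)$ has vertex set $\Gamma_f$, an edge $\beta_1\to\beta_2$ whenever $\beta_2/\beta_1=g(\alpha)$ for some (unique) $g\in P_d$, with weight $\Lambda(g)$. Its weighted adjacency operator acts on functions $h:\Gamma_f\to\mathbb{C}$ by $M^*(h)(x)=\sum_{g\in P_d}\Lambda(g)h(xg(\alpha))$. Each multiplicative character $\chi$ of $\Gamma_f$ is an eigenvector with eigenvalue $S_d(\chi)=\sum_{g\in P_d}\Lambda(g)\chi(g(\alpha))$; for $\chi$ trivial on $H$ this is the trivial eigenvalue $\lambda_{triv}=q^d$,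 and a non-trivial eigenvalue is $S_d(\chi)$ for $\chi$ non-trivial on $H$. *)

theory Defs
  imports
    Complex_Main
    "HOL-Computational_Algebra.Polynomial_Factorial"
    "Graph_Theory.Pair_Digraph"
    "Graph_Theory.Weighted_Graph"
begin

section \<open>The field extension and its multiplicative group\<close>

text \<open>
  The fields \<open>F_q \<subseteq> F_{q^n}\<close> are two finite field types together with a unital ring
  homomorphism \<open>\<iota>\<close>, which is automatically injective.
\<close>

definition field_embedding :: "('a::field \<Rightarrow> 'b::field) \<Rightarrow> bool" where
  "field_embedding \<iota> \<longleftrightarrow>
     \<iota> 1 = 1 \<and> (\<forall>x y. \<iota> (x + y) = \<iota> x + \<iota> y) \<and> (\<forall>x y. \<iota> (x * y) = \<iota> x * \<iota> y)"

definition eval_at :: "('a::field \<Rightarrow> 'b::field) \<Rightarrow> 'b \<Rightarrow> 'a poly \<Rightarrow> 'b" where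
  "eval_at \<iota> \<alpha> g = poly (map_poly \<iota> g) \<alpha>"

definition mult_group :: "'b::field set" where
  "mult_group = UNIV - {0}"

definition mult_subgroup :: "'b::field set \<Rightarrow> bool" where
  "mult_subgroup U \<longleftrightarrow> U \<subseteq> mult_group \<and> 1 \<in> U \<and>
     (\<forall>x\<in>U. \<forall>y\<in>U. x * y \<in> U) \<and> (\<forall>x\<in>U. inverse x \<in> U)"

text \<open>
  Functions on the multiplicative group are total functions on the field; their value at \<open>0\<close>
  is irrelevant and left unconstrained everywhere below.
\<close>

definition mult_character :: "('b::field \<Rightarrow> complex) \<Rightarrow> bool" where
  "mult_character \<chi> \<longleftrightarrow> (\<forall>x\<in>mult_group. \<chi> x \<noteq> 0) \<and>
     (\<forall>x\<in>mult_group. \<forall>y\<in>mult_group. \<chi> (x * y) = \<chi> x * \<chi> y)"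


section \<open>Primary polynomials\<close>

definition primary :: "'a::field poly \<Rightarrow> bool" where
  "primary g \<longleftrightarrow> degree g > 0 \<and> (\<exists>p k. irreducible p \<and> g = p ^ k)"

definition monic_primaries :: "nat \<Rightarrow> 'a::field poly set" where
  "monic_primaries d = {g. lead_coeff g = 1 \<and> primary g \<and> degree g = d}"

text \<open>The irreducible factor of a primary polynomial is unique only once it is taken monic.\<close>

definition Lambda :: "'a::field poly \<Rightarrow> nat" where
  "Lambda g = degree (THE p. irreducible p \<and> lead_coeff p = 1 \<and> p dvd g)"

definition H_subgroup :: "('a::field \<Rightarrow> 'b::field) \<Rightarrow> 'b \<Rightarrow> nat \<Rightarrow> 'b set" where
  "H_subgroup \<iota> \<alpha> d = mult_subgroup hull (eval_at \<iota> \<alpha> ` monic_primaries d)"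


section \<open>Weighted graphs and expanders\<close>

definition weighted_adjacency ::
  "'v pair_pre_digraph \<Rightarrow> ('v \<times> 'v) weight_fun \<Rightarrow> ('v \<Rightarrow> complex) \<Rightarrow> 'v \<Rightarrow> complex" where
  "weighted_adjacency G w h x = (\<Sum>y | (x, y) \<in> parcs G. of_real (w (x, y)) * h y)"

definition is_eigenvector ::
  "'v set \<Rightarrow> (('v \<Rightarrow> complex) \<Rightarrow> 'v \<Rightarrow> complex) \<Rightarrow> ('v \<Rightarrow> complex) \<Rightarrow> complex \<Rightarrow> bool" where
  "is_eigenvector V A h l \<longleftrightarrow> (\<exists>x\<in>V. h x \<noteq> 0) \<and> (\<forall>x\<in>V. A h x = l * h x)"

definition weighted_regular ::
  "'v pair_pre_digraph \<Rightarrow> ('v \<times> 'v) weight_fun \<Rightarrow> real \<Rightarrow> bool" where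
  "weighted_regular G w k \<longleftrightarrow> (\<forall>x\<in>pverts G.
     (\<Sum>y | (x, y) \<in> parcs G. w (x, y)) = k \<and> (\<Sum>y | (y, x) \<in> parcs G. w (y, x)) = k)"

text \<open>
  In a \<open>k\<close>-regular weighted digraph the constants are eigenvectors of eigenvalue \<open>k\<close> and the
  functions of sum \<open>0\<close> form an invariant complement.  An expander has spectral gap \<open>\<delta>\<close> on
  that complement; in particular \<open>k\<close> is then a simple eigenvalue and the graph is connected.
\<close>

definition expander_graph ::
  "'v pair_pre_digraph \<Rightarrow> ('v \<times> 'v) weight_fun \<Rightarrow> real \<Rightarrow> real \<Rightarrow> bool" where
  "expander_graph G w k \<delta> \<longleftrightarrow>
     pair_fin_digraph G \<and> pverts G \<noteq> {} \<and> (\<forall>e\<in>parcs G. w e > 0) \<and>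
     weighted_regular G w k \<and> k > 0 \<and> \<delta> > 0 \<and>
     (\<forall>h l. is_eigenvector (pverts G) (weighted_adjacency G w) h l \<and> (\<Sum>x\<in>pverts G. h x) = 0
            \<longrightarrow> cmod l \<le> k * (1 - \<delta>))"


section \<open>The graph and its adjacency operator\<close>

definition Gd_graph :: "('a::field \<Rightarrow> 'b::field) \<Rightarrow> 'b \<Rightarrow> nat \<Rightarrow> 'b pair_pre_digraph" where
  "Gd_graph \<iota> \<alpha> d =
     \<lparr> pverts = mult_group,
       parcs = {(b1, b2). b1 \<in> mult_group \<and> b2 \<in> mult_group \<and>
                          (\<exists>g\<in>monic_primaries d. b2 / b1 = eval_at \<iota> \<alpha> g)} \<rparr>"

definition Gd_weight :: "('a::field \<Rightarrow> 'b::field) \<Rightarrow> 'b \<Rightarrow> nat \<Rightarrow> ('b \<times> 'b) weight_fun" where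
  "Gd_weight \<iota> \<alpha> d e =
     real (Lambda (THE g. g \<in> monic_primaries d \<and> snd e / fst e = eval_at \<iota> \<alpha> g))"

definition M_star ::
  "('a::field \<Rightarrow> 'b::field) \<Rightarrow> 'b \<Rightarrow> nat \<Rightarrow> ('b \<Rightarrow> complex) \<Rightarrow> 'b \<Rightarrow> complex" where
  "M_star \<iota> \<alpha> d h x =
     (\<Sum>g\<in>monic_primaries d. of_nat (Lambda g) * h (x * eval_at \<iota> \<alpha> g))"

definition S_sum :: "('a::field \<Rightarrow> 'b::field) \<Rightarrow> 'b \<Rightarrow> nat \<Rightarrow> ('b \<Rightarrow> complex) \<Rightarrow> complex" where
  "S_sum \<iota> \<alpha> d \<chi> = (\<Sum>g\<in>monic_primaries d. of_nat (Lambda g) * \<chi> (eval_at \<iota> \<alpha> g))"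

text \<open>
  The eigenvalues of \<open>M_star\<close> at the characters that are non-trivial on \<open>H_subgroup\<close>.  They are
  the values of \<open>S_sum\<close> at these characters: see \<open>nontrivial_eigenvalue_iff\<close> below.
\<close>

definition nontrivial_eigenvalue ::
  "('a::field \<Rightarrow> 'b::field) \<Rightarrow> 'b \<Rightarrow> nat \<Rightarrow> complex \<Rightarrow> bool" where
  "nontrivial_eigenvalue \<iota> \<alpha> d l \<longleftrightarrow>
     (\<exists>\<chi>. mult_character \<chi> \<and> (\<exists>x\<in>H_subgroup \<iota> \<alpha> d. \<chi> x \<noteq> 1) \<and>
          is_eigenvector mult_group (M_star \<iota> \<alpha> d) \<chi> l)"


section \<open>Consistency of the definitions\<close>

lemma field_embedding_0: "field_embedding \<iota> \<Longrightarrow> \<iota> 0 = 0"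
  unfolding field_embedding_def by (metis add_cancel_right_right)

lemma field_embedding_eq_0_iff:
  assumes "field_embedding \<iota>" shows "\<iota> x = 0 \<longleftrightarrow> x = 0"
proof
  assume "\<iota> x = 0"
  show "x = 0"
  proof (rule ccontr)
    assume "x \<noteq> 0"
    hence "1 = \<iota> (x * inverse x)" using assms by (simp add: field_embedding_def)
    also have "\<dots> = 0" using assms \<open>\<iota> x = 0\<close> by (simp add: field_embedding_def)
    finally show False by simp
  qed
qed (use assms in \<open>simp add: field_embedding_0\<close>)

lemma eval_at_pCons:
  "field_embedding \<iota> \<Longrightarrow> eval_at \<iota> \<alpha> (pCons c p) = \<iota> c + \<alpha> * eval_at \<iota> \<alpha> p"
  by (simp add: eval_at_def map_poly_pCons field_embedding_0)

lemma eval_at_0: "eval_at \<iota> \<alpha> 0 = 0"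
  by (simp add: eval_at_def)

lemma eval_at_add:
  assumes "field_embedding \<iota>"
  shows "eval_at \<iota> \<alpha> (p + r) = eval_at \<iota> \<alpha> p + eval_at \<iota> \<alpha> r"
  using assms
  by (induction p r rule: poly_induct2)
     (auto simp: eval_at_0 eval_at_pCons field_embedding_def algebra_simps)

lemma eval_at_smult:
  assumes "field_embedding \<iota>"
  shows "eval_at \<iota> \<alpha> (smult c p) = \<iota> c * eval_at \<iota> \<alpha> p"
  using assms
  by (induction p) (auto simp: eval_at_0 eval_at_pCons field_embedding_def algebra_simps)

lemma eval_at_mult:
  assumes "field_embedding \<iota>"
  shows "eval_at \<iota> \<alpha> (p * r) = eval_at \<iota> \<alpha> p * eval_at \<iota> \<alpha> r"
  using assms
  by (induction p)
     (auto simp: eval_at_0 eval_at_pCons eval_at_add eval_at_smult field_embedding_0 algebra_simps)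

lemma eval_at_diff:
  assumes "field_embedding \<iota>"
  shows "eval_at \<iota> \<alpha> (p - r) = eval_at \<iota> \<alpha> p - eval_at \<iota> \<alpha> r"
  using eval_at_add[OF assms, of \<alpha> "p - r" r] by simp

lemma eval_at_nonzero:
  fixes \<iota> :: "'a::field \<Rightarrow> 'b::field"
  assumes emb: "field_embedding \<iota>" and f: "irreducible f" "eval_at \<iota> \<alpha> f = 0"
    and g: "g \<noteq> 0" "degree g < degree f"
  shows "eval_at \<iota> \<alpha> g \<noteq> 0"
proof
  assume g0: "eval_at \<iota> \<alpha> g = 0"
  define P where "P = (\<lambda>k. \<exists>m. m \<noteq> 0 \<and> eval_at \<iota> \<alpha> m = 0 \<and> degree m = k)"
  have "P (degree g)" using g g0 by (auto simp: P_def)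
  hence "P (LEAST k. P k)" and le: "(LEAST k. P k) \<le> degree g"
    by (auto intro: LeastI Least_le)
  then obtain m where m: "m \<noteq> 0" "eval_at \<iota> \<alpha> m = 0" "degree m = (LEAST k. P k)"
    by (auto simp: P_def)
  have "eval_at \<iota> \<alpha> (f mod m) = 0"
    using eval_at_diff[OF emb, of \<alpha> f "(f div m) * m"] f(2) m(2)
    by (simp add: eval_at_mult[OF emb] minus_div_mult_eq_mod)
  moreover have "f mod m = 0 \<or> degree (f mod m) < degree m"
    by (rule degree_mod_less[OF m(1)])
  ultimately have "f mod m = 0"
    using m(3) not_less_Least[of _ P] by (auto simp: P_def)
  then obtain c where c: "f = m * c" by (metis dvd_def mod_0_imp_dvd)
  with f(1) have "is_unit m \<or> is_unit c" by (auto dest: irreducibleD)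
  thus False
  proof
    assume "is_unit m"
    then obtain m' where "1 = m * m'" by (auto simp: dvd_def)
    hence "eval_at \<iota> \<alpha> 1 = 0" using m(2) by (metis eval_at_mult[OF emb] mult_zero_left)
    moreover have "eval_at \<iota> \<alpha> 1 = 1"
      using emb by (simp add: eval_at_def field_embedding_def)
    ultimately show False by simp
  next
    assume "is_unit c"
    moreover have "c \<noteq> 0" using calculation by auto
    ultimately have "degree f = degree m"
      using c m(1) by (simp add: degree_mult_eq is_unit_iff_degree)
    thus False using m(3) le g(2) by simp
  qed
qed

lemma finite_monic_primaries: "finite (monic_primaries d :: 'a::{field,finite} poly set)"
proof (rule finite_imageD)
  show "finite (coeffs ` (monic_primaries d :: 'a poly set))"
    by (rule finite_subset[OF _ finite_lists_length_le[of "UNIV :: 'a set" "Suc d"]])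
       (auto simp: monic_primaries_def length_coeffs_degree coeffs_def)
  show "inj_on coeffs (monic_primaries d :: 'a poly set)"
    by (auto simp: inj_on_def coeffs_eq_iff)
qed

lemma inj_on_eval_at_monic_primaries:
  fixes \<iota> :: "'a::field \<Rightarrow> 'b::field"
  assumes emb: "field_embedding \<iota>" and f: "irreducible f" "eval_at \<iota> \<alpha> f = 0"
    and d: "d < degree f"
  shows "inj_on (eval_at \<iota> \<alpha>) (monic_primaries d)"
proof (rule inj_onI, rule ccontr)
  fix g g' :: "'a poly"
  assume gg: "g \<in> monic_primaries d" "g' \<in> monic_primaries d"
    "eval_at \<iota> \<alpha> g = eval_at \<iota> \<alpha> g'" "g \<noteq> g'"
  hence "degree (g - g') < degree f"
    using d degree_diff_le[of g d g'] by (auto simp: monic_primaries_def)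
  hence "eval_at \<iota> \<alpha> (g - g') \<noteq> 0"
    using eval_at_nonzero[OF emb f, of "g - g'"] gg(4) by simp
  thus False using gg(3) by (simp add: eval_at_diff[OF emb])
qed

lemma eval_at_monic_primaries_nonzero:
  assumes "field_embedding \<iota>" "irreducible f" "eval_at \<iota> \<alpha> f = 0" "d < degree f"
    "g \<in> monic_primaries d"
  shows "eval_at \<iota> \<alpha> g \<noteq> 0"
  using assms eval_at_nonzero[OF assms(1-3), of g]
  by (cases "g = 0") (auto simp: monic_primaries_def)

lemma M_star_character:
  assumes "field_embedding \<iota>" "irreducible f" "eval_at \<iota> \<alpha> f = 0" "d < degree f"
    and "mult_character \<chi>" "x \<noteq> 0"
  shows "M_star \<iota> \<alpha> d \<chi> x = S_sum \<iota> \<alpha> d \<chi> * \<chi> x"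
  using assms(5,6) eval_at_monic_primaries_nonzero[OF assms(1-4)]
  by (auto simp: M_star_def S_sum_def sum_distrib_right mult_character_def mult_group_def
      intro!: sum.cong)

lemma nontrivial_eigenvalue_iff:
  assumes "field_embedding \<iota>" "irreducible f" "eval_at \<iota> \<alpha> f = 0" "d < degree f"
  shows "nontrivial_eigenvalue \<iota> \<alpha> d l \<longleftrightarrow>
    (\<exists>\<chi>. mult_character \<chi> \<and> (\<exists>x\<in>H_subgroup \<iota> \<alpha> d. \<chi> x \<noteq> 1) \<and> l = S_sum \<iota> \<alpha> d \<chi>)"
proof -
  have "is_eigenvector mult_group (M_star \<iota> \<alpha> d) \<chi> l \<longleftrightarrow> l = S_sum \<iota> \<alpha> d \<chi>"
    if "mult_character \<chi>" for \<chi>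
  proof -
    have 1: "1 \<in> mult_group" "\<chi> 1 \<noteq> 0" using that by (auto simp: mult_group_def mult_character_def)
    have M: "M_star \<iota> \<alpha> d \<chi> x = S_sum \<iota> \<alpha> d \<chi> * \<chi> x" if "x \<in> mult_group" for x
      using M_star_character[OF assms \<open>mult_character \<chi>\<close>] that by (auto simp: mult_group_def)
    show ?thesis unfolding is_eigenvector_def using 1 M by auto
  qed
  thus ?thesis unfolding nontrivial_eigenvalue_def by blast
qed

lemma weighted_adjacency_Gd_graph:
  fixes \<iota> :: "'a::{field,finite} \<Rightarrow> 'b::field"
  assumes "field_embedding \<iota>" "irreducible f" "eval_at \<iota> \<alpha> f = 0" "d < degree f"
    and x: "x \<in> mult_group"
  shows "weighted_adjacency (Gd_graph \<iota> \<alpha> d) (Gd_weight \<iota> \<alpha> d) h x = M_star \<iota> \<alpha> d h x"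
proof -
  let ?P = "monic_primaries d :: 'a poly set" and ?w = "\<lambda>g. x * eval_at \<iota> \<alpha> g"
  have x0: "x \<noteq> 0" using x by (simp add: mult_group_def)
  have inj: "inj_on (eval_at \<iota> \<alpha>) ?P" by (rule inj_on_eval_at_monic_primaries[OF assms(1-4)])
  have inj': "inj_on ?w ?P" using inj x0 by (auto simp: inj_on_def)
  have img: "{y. (x, y) \<in> parcs (Gd_graph \<iota> \<alpha> d)} = ?w ` ?P"
    using x0 eval_at_monic_primaries_nonzero[OF assms(1-4)]
    by (auto simp: Gd_graph_def mult_group_def field_simps image_iff)
  have w: "Gd_weight \<iota> \<alpha> d (x, ?w g) = real (Lambda g)" if "g \<in> ?P" for g
  proof -
    have "(THE g'. g' \<in> ?P \<and> eval_at \<iota> \<alpha> g = eval_at \<iota> \<alpha> g') = g"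
      using that inj by (intro the_equality) (auto dest: inj_onD)
    thus ?thesis using x0 by (simp add: Gd_weight_def)
  qed
  show ?thesis
    unfolding weighted_adjacency_def M_star_def img
    by (simp add: sum.reindex[OF inj'] w)
qed

end

theory Submission
  imports
    "HOL-Analysis.Kronecker_Approximation_Theorem"
    "HOL-Algebra.Algebraic_Closure_Type"
    Defs
begin

hide_const (open) Divisibility.irreducible Divisibility.prime

text \<open>
  Everything reduces to the Weil bound \<open>|S_d(\<psi>)| \<le> (n - 1) q^(d/2)\<close> for every non-trivial character
  \<open>\<psi>\<close> of the multiplicative group of \<open>F_{q^n}\<close>.

  The L-function \<open>L(u) = \<Sum>\<^sub>h \<psi>(h(\<alpha>)) u^(deg h)\<close>, summed over the monic polynomials \<open>h\<close>, is a
  polynomial of degree below \<open>n\<close>, because in degree at least \<open>n\<close> the values \<open>h(\<alpha>)\<close> are equidistributed.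
  Unique factorization turns its logarithmic derivative into the sums \<open>S_r(\<psi>)\<close>, so
  \<open>S_r(\<psi>) = - \<Sum>\<^sub>i w\<^sub>i^r\<close> with fewer than \<open>n\<close> terms.  By Dirichlet approximation it is then enough to
  bound \<open>S_r(\<psi>)\<close> by \<open>C q^(r/2)\<close> for large multiples \<open>r = 2tn\<close> of \<open>2n\<close>, where \<open>C\<close> may be any constant.

  Replacing a primary polynomial by its roots in the algebraic closure, the weighted number of
  \<open>g \<in> P_r\<close> with \<open>g(\<alpha>) = z\<close> is at most the number of \<open>b\<close> in \<open>F_{q^r}\<close> with
  \<open>\<Prod>\<^sub>i (\<alpha> - b^(q^i)) = z\<close>.  This norm is a power of a fixed polynomial \<open>G\<close> in \<open>b - \<alpha>\<close> with a simple
  zero at \<open>0\<close>, and the method of Stepanov, in the form given to it by Bombieri, bounds the number of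
  such \<open>b\<close> by \<open>q^r / (q^n - 1) + O(q^(r/2))\<close>.  An upper bound for all \<open>z\<close> suffices, since the weighted numbers
  of \<open>g\<close> add up to \<open>q^r\<close>.

  Fourier analysis on the cyclic group shows that an eigenvalue with an eigenfunction of sum zero is
  some \<open>S_d(\<psi>)\<close> with \<open>\<psi>\<close> non-trivial, whence the expander property.
\<close>


section \<open>The polynomial method of Stepanov and Bombieri\<close>

text \<open>Gaussian elimination: an equation with a non-zero coefficient at \<open>i0\<close>
  serves to eliminate that unknown from the others, at the cost of one equation and one
  unknown.\<close>

lemma homogeneous_system_nontrivial:
  fixes a :: "'j \<Rightarrow> 'i \<Rightarrow> 'k::field"
  assumes "finite J" "finite I" "card J < card I"
  shows "\<exists>x. (\<exists>i\<in>I. x i \<noteq> 0) \<and> (\<forall>j\<in>J. (\<Sum>i\<in>I. a j i * x i) = 0)"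
  using assms
proof (induction J arbitrary: I a rule: finite_induct)
  case empty
  hence "I \<noteq> {}" by auto
  thus ?case by (intro exI[of _ "\<lambda>_. 1"]) auto
next
  case (insert j J)
  show ?case
  proof (cases "\<forall>i\<in>I. a j i = 0")
    case True
    obtain x where x: "\<exists>i\<in>I. x i \<noteq> 0" "\<forall>j\<in>J. (\<Sum>i\<in>I. a j i * x i) = 0"
      using insert.IH[of I a] insert.prems insert.hyps by auto
    with True show ?thesis by (intro exI[of _ x]) auto
  next
    case False
    then obtain i0 where i0: "i0 \<in> I" "a j i0 \<noteq> 0" by auto
    define I' where "I' = I - {i0}"
    have I': "finite I'" "i0 \<notin> I'" "I = insert i0 I'"
      using insert.prems i0 by (auto simp: I'_def)
    have "card J < card I'"
      using insert.prems insert.hyps I' by simp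
    then obtain x where x: "\<exists>i\<in>I'. x i \<noteq> 0"
      "\<forall>j'\<in>J. (\<Sum>i\<in>I'. (a j' i - a j' i0 * a j i / a j i0) * x i) = 0"
      using insert.IH[of I' "\<lambda>j' i. a j' i - a j' i0 * a j i / a j i0"] I' by auto
    define y where "y = x(i0 := - (\<Sum>i\<in>I'. a j i * x i) / a j i0)"
    have y: "(\<Sum>i\<in>I. a j' i * y i) = a j' i0 * y i0 + (\<Sum>i\<in>I'. a j' i * x i)" for j'
      using I' by (auto simp: y_def intro!: sum.cong)
    have "(\<Sum>i\<in>I. a j' i * y i) = (\<Sum>i\<in>I'. (a j' i - a j' i0 * a j i / a j i0) * x i)" for j'
      unfolding y
      by (simp add: y_def left_diff_distrib sum_subtractf sum_distrib_left sum_divide_distrib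
          mult.assoc)
    hence "\<forall>j'\<in>J. (\<Sum>i\<in>I. a j' i * y i) = 0" using x(2) by simp
    moreover have "(\<Sum>i\<in>I. a j i * y i) = 0"
      unfolding y using i0 by (simp add: y_def)
    moreover have "\<exists>i\<in>I. y i \<noteq> 0"
      using x(1) I' by (auto simp: y_def)
    ultimately show ?thesis by (intro exI[of _ y]) auto
  qed
qed

lemma additive_power_sum:
  fixes f :: "'i \<Rightarrow> 'k::comm_semiring_1"
  assumes "\<And>x y :: 'k. (x + y) ^ m = x ^ m + y ^ m" "m > 0"
  shows "(\<Sum>i\<in>I. f i) ^ m = (\<Sum>i\<in>I. f i ^ m)"
  by (induction I rule: infinite_finite_induct) (use assms in \<open>auto simp: power_0_left\<close>)

lemma add_mult_inject:
  fixes x m :: nat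
  assumes "x < m" "x' < m" "x + m * l = x' + m * l'"
  shows "x = x' \<and> l = l'"
  using arg_cong[OF assms(3), of "\<lambda>x. x div m"] arg_cong[OF assms(3), of "\<lambda>x. x mod m"] assms(1,2)
  by simp

text \<open>Since \<open>u * s = m - 1\<close>, the exponent \<open>u * (m + 1)\<close> is (m^2 - 1)
  / s, so the expected size of \<open>A\<close> is about m^2 / s and the error allowed is of order
  m. The polynomial \<open>F\<close> vanishing on \<open>A\<close> has small degree itself, while
  the m-th powers of its values lead to a polynomial \<open>H\<close> small enough to be annihilated
  by linear algebra.\<close>

lemma stepanov_bound:
  fixes G U :: "'k::alg_closed_field poly"
  assumes frob: "\<And>x y :: 'k. (x + y) ^ m = x ^ m + y ^ m"
    and G: "G = [:0, 1:] * U" "poly U 0 \<noteq> 0"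
    and m: "m = u * s + 1" "u > 0" "m > 2 * degree G + 6"
    and z: "z \<noteq> 0"
    and A: "\<And>x. x \<in> A \<Longrightarrow> x ^ (m ^ 2) = x \<and> poly G x ^ (u * (m + 1)) = z"
  shows "finite A \<and> s * card A \<le> m ^ 2 + m * s * (2 * degree G + 3)"
proof -
  define D where "D = degree G"
  \<comment> \<open>The degree of \<open>F\<close> grows like \<open>m * b\<close>, so
    \<open>b\<close> should be as small as the count of unknowns permits. The summand 3 is what
    makes \<open>card J < card I\<close>, by way of
    \<open>2 * u + 2 * D + 3 < 3 * (u * s)\<close>.\<close>
  define b where "b = u + D + 3"
  define I where "I = {..<s} \<times> {..<u} \<times> {..<b}"
  \<comment> \<open>One equation for each exponent that can occur in \<open>H\<close>.\<close>
  define J where "J = {..<u * m + b + m * D}"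
  have s: "s > 0" using m by (cases s) auto
  have us: "u \<le> u * s" using s by simp
  have D: "2 * D + 5 < u * s" using m by (simp add: D_def)
  have fin: "finite I" "finite J" by (simp_all add: I_def J_def)
  have "card J < card I"
  proof -
    have "card I = (u * s) * (u + D + 3)" by (simp add: I_def b_def mult_ac)
    moreover have "card J = u * (u * s + 1) + (u + D + 3) + (u * s + 1) * D"
      by (simp add: J_def b_def m(1))
    moreover have "2 * u + 2 * D + 3 < 3 * (u * s)" using us D by linarith
    ultimately show ?thesis by (simp add: algebra_simps)
  qed
  from homogeneous_system_nontrivial[OF fin(2,1) this, of "\<lambda>e (j, k, l).
      z ^ j * coeff (monom 1 (m * k + l) * G ^ (u * (s - 1 - j))) e"]
  obtain y where y: "\<exists>i\<in>I. y i \<noteq> 0"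
    "\<forall>e\<in>J. (\<Sum>i\<in>I. (case i of (j, k, l) \<Rightarrow>
        z ^ j * coeff (monom 1 (m * k + l) * G ^ (u * (s - 1 - j))) e) * y i) = 0"
    by (elim exE conjE)
  have "\<exists>c. \<forall>i. c i ^ m = y i"
    using nth_root_exists[of m] m by (intro choice) auto
  then obtain c where c: "\<And>i. c i ^ m = y i" by auto
  text \<open>
    On \<open>A\<close> the Frobenius relations give \<open>F(x)^m G(x)^(u (s - 1)) = H(x)\<close>.  The coefficients \<open>y\<close> are chosen
    such that \<open>H = 0\<close>, while \<open>F \<noteq> 0\<close> because its terms have distinct orders of vanishing at \<open>0\<close>.
  \<close>
  define F where "F = (\<Sum>(j, k, l)\<in>I. smult (c (j, k, l)) (monom 1 (k + m * l) * G ^ (u * j)))"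
  define H where "H = (\<Sum>(j, k, l)\<in>I. smult (z ^ j * y (j, k, l))
      (monom 1 (m * k + l) * G ^ (u * (s - 1 - j))))"
  \<comment> \<open>\<open>e\<close> is the order of vanishing at 0 of the term of \<open>F\<close>
    with index (j, k, l), because \<open>G\<close> has a simple zero there.\<close>
  define e where "e = (\<lambda>(j, k, l). k + m * l + u * j)"

  have deg_G: "degree (monom (1 :: 'k) N * G ^ k) \<le> N + D * k" for N k
    by (intro order.trans[OF degree_mult_le] add_mono order.trans[OF degree_power_le])
       (auto simp: degree_monom_le D_def)
  have H0: "H = 0"
  proof (rule poly_eqI)
    fix N
    show "coeff H N = coeff 0 N"
    proof (cases "N \<in> J")
      case True
      have "coeff H N = (\<Sum>i\<in>I. (case i of (j, k, l) \<Rightarrow>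
        z ^ j * coeff (monom 1 (m * k + l) * G ^ (u * (s - 1 - j))) N) * y i)"
        unfolding H_def coeff_sum by (intro sum.cong) (auto simp: mult_ac)
      thus ?thesis using y(2) True by simp
    next
      case False
      have "coeff (monom 1 (m * k + l) * G ^ (u * (s - 1 - j))) N = 0"
        if "(j, k, l) \<in> I" for j k l
      proof (rule coeff_eq_0)
        have 1: "Suc k \<le> u" "l < b" using that by (auto simp: I_def)
        have "m * Suc k \<le> m * u" using 1 by (intro mult_le_mono) auto
        moreover have "D * (u * (s - 1 - j)) \<le> D * m"
          unfolding m(1) by (intro mult_le_mono trans_le_add1) auto
        ultimately have "m * k + l + D * (u * (s - 1 - j)) < u * m + b + m * D"
          using 1 m by (simp add: algebra_simps)
        also have "\<dots> \<le> N" using False by (simp add: J_def)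
        finally show "degree (monom (1::'k) (m * k + l) * G ^ (u * (s - 1 - j))) < N"
          using deg_G[of "m * k + l" "u * (s - 1 - j)"] by linarith
      qed
      thus ?thesis unfolding H_def coeff_sum by (auto intro!: sum.neutral)
    qed
  qed

  \<comment> \<open>A mixed radix expansion: k is a digit to base u, and k + u * j is at most u * s
    - 1, hence a digit to base m followed by l.\<close>
  have inj: "inj_on e I"
  proof (rule inj_onI, clarsimp simp: I_def e_def)
    fix j k l j' k' l'
    assume *: "j < s" "k < u" "j' < s" "k' < u" "k + m * l + u * j = k' + m * l' + u * j'"
    have lt: "k + u * j < m" if "j < s" "k < u" for j k
    proof -
      have "u * Suc j \<le> u * s" using that by (intro mult_le_mono) auto
      thus ?thesis using that m(1) by simp
    qed
    have "(k + u * j) + m * l = (k' + u * j') + m * l'" using * by simp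
    from add_mult_inject[OF lt[OF *(1,2)] lt[OF *(3,4)] this]
    have 1: "k + u * j = k' + u * j'" "l = l'" by auto
    from add_mult_inject[OF *(2,4) 1(1)] 1(2)
    show "j = j' \<and> k = k' \<and> l = l'" by simp
  qed
  have F0: "F \<noteq> 0"
  proof -
    \<comment> \<open>Among the terms with non-zero coefficient, the one of least order cannot be
      cancelled: no other term contributes to the coefficient at \<open>e i0\<close>.\<close>
    let ?S = "{i \<in> I. c i \<noteq> 0}"
    have "?S \<noteq> {}" using y(1) c m by (metis (mono_tags, lifting) empty_iff mem_Collect_eq
          power_0_left add_is_0 zero_neq_one)
    moreover have "finite ?S" using fin by auto
    ultimately obtain i0 where i0: "i0 \<in> ?S" "\<forall>i\<in>?S. e i0 \<le> e i"
      by (metis (mono_tags, lifting) arg_min_if_finite(1) arg_min_least)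
    obtain j0 k0 l0 where i0': "i0 = (j0, k0, l0)" by (cases i0) auto
    have eq: "F = (\<Sum>i\<in>I. smult (c i) (monom 1 (e i) * U ^ (u * fst i)))"
      unfolding F_def
    proof (intro sum.cong refl, clarify)
      fix j k l
      have "G ^ (u * j) = monom 1 (u * j) * U ^ (u * j)"
        by (simp only: G(1) power_mult_distrib monom_altdef smult_1_left)
      thus "smult (c (j, k, l)) (monom 1 (k + m * l) * G ^ (u * j)) =
        smult (c (j, k, l)) (monom 1 (e (j, k, l)) * U ^ (u * fst (j, k, l)))"
        by (simp add: e_def mult_monom flip: mult.assoc)
    qed
    have "coeff F (e i0) = (\<Sum>i\<in>I. if i = i0 then c i0 * coeff (U ^ (u * j0)) 0 else 0)"
      unfolding eq coeff_sum
    proof (intro sum.cong refl)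
      fix i assume i: "i \<in> I"
      show "coeff (smult (c i) (monom 1 (e i) * U ^ (u * fst i))) (e i0) =
        (if i = i0 then c i0 * coeff (U ^ (u * j0)) 0 else 0)"
      proof (cases "i = i0 \<or> c i = 0")
        case False
        hence "e i0 < e i" using i i0 inj by (metis (mono_tags, lifting) inj_onD
              mem_Collect_eq order_le_less)
        thus ?thesis using False by (simp add: coeff_monom_mult)
      qed (auto simp: coeff_monom_mult i0')
    qed
    also have "\<dots> = c i0 * poly U 0 ^ (u * j0)"
      using i0 fin by (simp flip: poly_0_coeff_0 poly_power)
    also have "\<dots> \<noteq> 0" using i0 G(2) by simp
    finally show ?thesis by auto
  qed

  have root: "poly F x = 0" if "x \<in> A" for x
  proof -
    have x: "x ^ (m ^ 2) = x" "poly G x ^ (u * (m + 1)) = z" using A[OF that] by auto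
    let ?g = "poly G x"
    have g: "?g \<noteq> 0" using x(2) z m(2) by (auto simp: power_0_left)
    have "poly F x ^ m * ?g ^ (u * (s - 1)) =
      (\<Sum>(j, k, l)\<in>I. (c (j, k, l) * (x ^ (k + m * l) * ?g ^ (u * j))) ^ m) * ?g ^ (u * (s - 1))"
      using additive_power_sum[OF frob, of "\<lambda>(j, k, l). c (j, k, l) * (x ^ (k + m * l) * ?g ^ (u * j))" I] m
      by (simp add: F_def poly_sum poly_monom case_prod_unfold)
    also have "\<dots> = (\<Sum>(j, k, l)\<in>I. z ^ j * y (j, k, l) *
        (x ^ (m * k + l) * ?g ^ (u * (s - 1 - j))))"
      unfolding sum_distrib_right
    proof (intro sum.cong refl, clarify)
      fix j k l assume "(j, k, l) \<in> I"
      \<comment> \<open>The part \<open>u * j\<close> of the exponent \<open>u * (s - 1)\<close>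
        completes \<open>u * j * m\<close> to \<open>j\<close> times \<open>u * (m + 1)\<close>,
        which gives \<open>z ^ j\<close>. The remainder is the power of \<open>G\<close> in
        \<open>H\<close>.\<close>
      hence "s - 1 = j + (s - 1 - j)" by (auto simp: I_def)
      hence "u * (s - 1) = u * j + u * (s - 1 - j)" by (metis distrib_left)
      moreover have "(x ^ (k + m * l)) ^ m = x ^ (m * k + l)"
      proof -
        have "(x ^ (k + m * l)) ^ m = x ^ (m * k) * (x ^ (m ^ 2)) ^ l"
          by (simp add: power2_eq_square algebra_simps flip: power_mult power_add)
        thus ?thesis by (simp add: x(1) power_add)
      qed
      moreover have "(?g ^ (u * j)) ^ m * ?g ^ (u * j) = z ^ j"
        unfolding x(2)[symmetric] by (simp add: algebra_simps flip: power_mult power_add)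
      ultimately show "(c (j, k, l) * (x ^ (k + m * l) * ?g ^ (u * j))) ^ m * ?g ^ (u * (s - 1)) =
        z ^ j * y (j, k, l) * (x ^ (m * k + l) * ?g ^ (u * (s - 1 - j)))"
        by (simp add: power_mult_distrib c power_add)
    qed
    also have "\<dots> = poly H x"
      by (simp add: H_def poly_sum poly_monom case_prod_unfold)
    finally have "poly F x ^ m = 0" using H0 g by simp
    thus ?thesis by simp
  qed
  have sub: "A \<subseteq> {x. poly F x = 0}" using root by auto
  have finA: "finite A" by (rule finite_subset[OF sub poly_roots_finite[OF F0]])
  have "card A \<le> degree F"
    using card_mono[OF poly_roots_finite[OF F0] sub] card_poly_roots_bound[OF F0] by linarith
  also have "degree F \<le> u + m * (u + D + 2) + m * D"
    unfolding F_def
  proof (intro degree_sum_le fin, clarify)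
    fix j k l assume "(j, k, l) \<in> I"
    hence 1: "k \<le> u" "l \<le> u + D + 2" "u * j \<le> m"
      unfolding m(1) by (auto simp: I_def b_def intro!: le_SucI mult_le_mono)
    have "k + m * l + D * (u * j) \<le> u + m * (u + D + 2) + D * m"
      using 1 by (intro add_mono mult_le_mono) auto
    thus "degree (smult (c (j, k, l)) (monom 1 (k + m * l) * G ^ (u * j))) \<le>
      u + m * (u + D + 2) + m * D"
      using deg_G[of "k + m * l" "u * j"] degree_smult_le[of "c (j, k, l)"]
      by (metis (no_types, lifting) mult.commute order.trans)
  qed
  finally have "s * card A \<le> s * (u + m * (u + D + 2) + m * D)" by (rule mult_le_mono2)
  also have "\<dots> = (u * s) * (m + 1) + m * s * (2 * D + 2)" by (simp add: algebra_simps)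
  also have "(u * s) * (m + 1) \<le> m ^ 2" by (simp add: m(1) power2_eq_square)
  finally show ?thesis using finA by (simp add: D_def algebra_simps)
qed

section \<open>Growth of power sums\<close>

text \<open>A bound on the whole sum becomes a bound on each term. The constants \<open>C\<close>
  and \<open>t0\<close> do not appear in the conclusion, because a term of larger modulus would
  outgrow \<open>C * R ^ t\<close> at exponents where nothing cancels.\<close>

lemma power_sum_growth_bound:
  fixes z :: "nat \<Rightarrow> complex"
  assumes R: "R > 0" and bound: "\<And>t. t \<ge> t0 \<Longrightarrow> cmod (\<Sum>i<k. z i ^ t) \<le> C * R ^ t"
    and i: "i < k"
  shows "cmod (z i) \<le> R"
proof (rule ccontr)
  assume "\<not> cmod (z i) \<le> R"
  hence rho: "cmod (z i) / R > 1" using R by simp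
  obtain T where T: "2 * \<bar>C\<bar> < (cmod (z i) / R) ^ T"
    using real_arch_pow[OF rho] by blast
  \<comment> \<open>The arguments are multiplied by \<open>T'\<close> before the approximation, so
    that the exponent \<open>t\<close>, a positive multiple of \<open>T'\<close>, exceeds both
    \<open>T\<close> and \<open>t0\<close>. The precision of 1/6 of a full turn is the angle pi / 3,
    whose cosine is 1/2.\<close>
  define T' where "T' = T + t0 + 1"
  obtain t' p where t': "0 < t'"
    and p: "\<And>j. j < k \<Longrightarrow> \<bar>of_int t' * (of_nat T' * (Arg (z j) / (2 * pi))) - of_int (p j)\<bar> < 1 / real 6"
    using Dirichlet_approx_simult[of 6 k "\<lambda>j. of_nat T' * (Arg (z j) / (2 * pi))"] by (metis zero_less_numeral)
  define t where "t = nat t' * T'"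
  have tT: "t \<ge> T'" using t' by (cases "nat t'") (auto simp: t_def)
  text \<open>All \<open>z j ^ t\<close> lie in the sector of angle at most \<open>\<pi> / 3\<close> around the positive axis: no cancellation.\<close>
  have Re: "Re (z j ^ t) \<ge> cmod (z j) ^ t / 2" if "j < k" for j
  proof -
    define v where "v = real t * (Arg (z j) / (2 * pi)) - of_int (p j)"
    have v: "\<bar>v\<bar> < 1 / 6" using p[OF that] t' by (simp add: t_def v_def mult_ac)
    have "real t * Arg (z j) = 2 * pi * v + of_int (p j) * (2 * pi)"
      by (simp add: v_def algebra_simps)
    hence "cos (real t * Arg (z j)) = cos (2 * pi * v)"
      by (simp add: cos_add mult.commute[of _ "2 * pi"])
    also have "\<dots> = cos \<bar>2 * pi * v\<bar>" by simp
    also have "\<bar>2 * pi * v\<bar> = 2 * pi * \<bar>v\<bar>" by (simp add: abs_mult)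
    also have "cos (2 * pi * \<bar>v\<bar>) \<ge> cos (pi / 3)"
      using v by (intro cos_monotone_0_pi_le) auto
    finally have 1: "cos (real t * Arg (z j)) \<ge> 1 / 2" by (simp add: cos_60)
    have "z j ^ t = (of_real (cmod (z j)) * cis (Arg (z j))) ^ t"
      by (metis rcis_cmod_Arg rcis_def)
    also have "\<dots> = of_real (cmod (z j) ^ t) * cis (real t * Arg (z j))"
      by (simp only: power_mult_distrib Complex.DeMoivre of_real_power)
    finally have "Re (z j ^ t) = cmod (z j) ^ t * cos (real t * Arg (z j))" by simp
    thus ?thesis using mult_left_mono[OF 1, of "cmod (z j) ^ t"] by simp
  qed
  have "cmod (z i) ^ t / 2 \<le> (\<Sum>j<k. cmod (z j) ^ t / 2)"
    using i by (intro member_le_sum) auto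
  also have "\<dots> \<le> (\<Sum>j<k. Re (z j ^ t))" by (intro sum_mono Re) auto
  also have "\<dots> \<le> cmod (\<Sum>i<k. z i ^ t)" using complex_Re_le_cmod[of "\<Sum>i<k. z i ^ t"] by simp
  also have "\<dots> \<le> C * R ^ t" using tT by (intro bound) (auto simp: T'_def)
  finally have "(cmod (z i) / R) ^ t \<le> 2 * C" using R by (simp add: power_divide field_simps)
  moreover have "(cmod (z i) / R) ^ T \<le> (cmod (z i) / R) ^ t"
    using rho tT by (intro power_increasing) (auto simp: T'_def)
  ultimately show False using T by linarith
qed

section \<open>Monic primary polynomials and the Euler product\<close>

definition monics :: "nat \<Rightarrow> 'a::field poly set" where
  "monics m = {h. lead_coeff h = 1 \<and> degree h = m}"

text \<open>The condition is on coefficients and not on the degree, since the zero polynomial has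
  degree 0 and must belong to the set even for \<open>n = 0\<close>.\<close>

definition small_polys :: "nat \<Rightarrow> 'a::field poly set" where
  "small_polys n = {p. \<forall>i\<ge>n. coeff p i = 0}"

definition primary_divisors :: "'a::field poly \<Rightarrow> 'a poly set" where
  "primary_divisors h = {g. lead_coeff g = 1 \<and> primary g \<and> g dvd h}"

section \<open>Counting polynomials of given or bounded degree\<close>

lemma small_polys_iff: "p \<in> small_polys n \<longleftrightarrow> p = 0 \<or> degree p < n"
proof
  assume "p \<in> small_polys n"
  hence "\<forall>i\<ge>n. coeff p i = 0" by (simp add: small_polys_def)
  hence "n \<le> degree p \<Longrightarrow> lead_coeff p = 0" by blast
  thus "p = 0 \<or> degree p < n" using leading_coeff_0_iff[of p] not_less by blast
next
  assume p: "p = 0 \<or> degree p < n"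
  have "coeff p i = 0" if "i \<ge> n" for i
    using p that coeff_eq_0[of p i] by (cases "p = 0") simp_all
  thus "p \<in> small_polys n" by (simp add: small_polys_def)
qed

lemma finite_small_polys: "finite (small_polys n :: 'a::{field,finite} poly set)"
  and card_small_polys: "card (small_polys n :: 'a poly set) = CARD('a) ^ n"
proof -
  have "finite (small_polys n :: 'a poly set) \<and> card (small_polys n :: 'a poly set) = CARD('a) ^ n"
  proof (induction n)
    case 0
    have "small_polys 0 = {0 :: 'a poly}" by (auto simp: small_polys_def poly_eq_iff)
    thus ?case by simp
  next
    case (Suc n)
    let ?f = "\<lambda>(a :: 'a, p). pCons a p"
    have "small_polys (Suc n) = ?f ` (UNIV \<times> small_polys n)"
    proof (intro equalityI subsetI)
      fix p :: "'a poly" assume "p \<in> small_polys (Suc n)"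
      thus "p \<in> ?f ` (UNIV \<times> small_polys n)"
        by (cases p) (force simp: small_polys_def coeff_pCons image_iff split: nat.splits)
    qed (auto simp: small_polys_def coeff_pCons split: nat.splits)
    moreover have "inj_on ?f (UNIV \<times> small_polys n)" by (auto simp: inj_on_def)
    ultimately show ?case using Suc by (simp add: card_image card_cartesian_product)
  qed
  thus "finite (small_polys n :: 'a poly set)" "card (small_polys n :: 'a poly set) = CARD('a) ^ n"
    by auto
qed

lemma monics_eq: "monics m = (\<lambda>p. monom 1 m + p) ` small_polys m"
proof (intro equalityI subsetI)
  fix h :: "'a::field poly" assume "h \<in> monics m"
  hence "h - monom 1 m \<in> small_polys m"
    by (auto simp: monics_def small_polys_def coeff_eq_0)
  thus "h \<in> (\<lambda>p. monom 1 m + p) ` small_polys m" by (rule rev_image_eqI) simp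
next
  fix h :: "'a::field poly" assume "h \<in> (\<lambda>p. monom 1 m + p) ` small_polys m"
  then obtain p where p: "p \<in> small_polys m" "h = monom 1 m + p" by auto
  have 1: "coeff h m = 1" using p by (simp add: small_polys_def)
  have "degree h \<le> m" using p by (intro degree_le) (auto simp: small_polys_def)
  moreover have "degree h \<ge> m" using 1 by (intro le_degree) simp
  ultimately show "h \<in> monics m" using 1 by (simp add: monics_def)
qed

lemma finite_monics: "finite (monics m :: 'a::{field,finite} poly set)"
  by (simp add: monics_eq finite_small_polys)

lemma card_monics: "card (monics m :: 'a::{field,finite} poly set) = CARD('a) ^ m"
  by (simp add: monics_eq card_image card_small_polys)

lemma monics_0: "monics 0 = {1}"
  by (auto simp: monics_def elim!: degree_eq_zeroE)

section \<open>Factorization into monic irreducible polynomials\<close>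

lemma monic_unique_irreducible_factor:
  fixes p r :: "'a::field poly"
  assumes "irreducible p" "irreducible r" "lead_coeff p = 1" "lead_coeff r = 1" "p dvd r"
  shows "p = r"
proof -
  obtain c where c: "r = p * c" using assms(5) by (auto simp: dvd_def)
  have "is_unit c" using assms(1,2) c Factorial_Ring.irreducibleD irreducible_not_unit by blast
  then obtain a where a: "c = [:a:]" by (elim is_unit_polyE)
  have "a = 1" using assms c a by (cases "a = 0") auto
  thus ?thesis using c a by simp
qed

text \<open>A divisor of least positive degree is irreducible, and scaling makes it monic.\<close>

lemma monic_irreducible_factor_exists:
  fixes h :: "'a::field poly"
  assumes "degree h > 0"
  shows "\<exists>p. irreducible p \<and> lead_coeff p = 1 \<and> p dvd h"
proof -
  define P where "P = (\<lambda>k. \<exists>p. p dvd h \<and> degree p = k \<and> k > 0)"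
  have "P (degree h)" unfolding P_def using assms by (intro exI[of _ h]) simp
  hence "P (LEAST k. P k)" by (rule LeastI)
  then obtain p where p: "p dvd h" "degree p = (LEAST k. P k)" "degree p > 0"
    unfolding P_def by auto
  have p0: "p \<noteq> 0" using p(3) by auto
  have irr: "irreducible p"
  proof (rule Factorial_Ring.irreducibleI)
    show "\<not> is_unit p" using p(3) by (auto simp: is_unit_iff_degree p0)
    fix a b assume ab: "p = a * b"
    hence nz: "a \<noteq> 0" "b \<noteq> 0" using p0 by auto
    have "degree a + degree b = degree p" using ab nz by (simp add: degree_mult_eq)
    moreover have "degree a = 0 \<or> degree a \<ge> degree p"
    proof (cases "degree a = 0")
      case False
      hence "P (degree a)" using ab p(1) unfolding P_def by (metis dvd_mult_left gr0I)
      thus ?thesis using p(2) by (simp add: Least_le)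
    qed simp
    ultimately have "degree a = 0 \<or> degree b = 0" by linarith
    thus "is_unit a \<or> is_unit b" using nz by (simp add: is_unit_iff_degree)
  qed (rule p0)
  let ?p = "smult (inverse (lead_coeff p)) p"
  have "irreducible ?p"
  proof -
    have "?p = [:inverse (lead_coeff p):] * p" by simp
    moreover have "is_unit [:inverse (lead_coeff p):]"
      using p0 by (simp add: is_unit_iff_degree)
    ultimately show ?thesis using irr irreducible_mult_unit_left by metis
  qed
  moreover have "lead_coeff ?p = 1" "?p dvd h" using p0 p(1) by (simp_all add: smult_dvd)
  ultimately show ?thesis by blast
qed

lemma Lambda_power:
  fixes p :: "'a::field poly"
  assumes "irreducible p" "lead_coeff p = 1" "k > 0"
  shows "Lambda (p ^ k) = degree p"
proof -
  have "(THE r. irreducible r \<and> lead_coeff r = 1 \<and> r dvd p ^ k) = p"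
  proof (rule the_equality)
    fix r assume r: "irreducible r \<and> lead_coeff r = 1 \<and> r dvd p ^ k"
    hence "r dvd p" using field_poly_irreducible_imp_prime prime_elem_dvd_power by blast
    thus "r = p" using r assms monic_unique_irreducible_factor by blast
  qed (use assms in auto)
  thus ?thesis by (simp add: Lambda_def)
qed

lemma degree_irreducible_pos: "irreducible (p :: 'a::field poly) \<Longrightarrow> degree p > 0"
  by (metis gr0I Factorial_Ring.irreducible_def is_unit_iff_degree)

lemma monic_primary_power:
  fixes p :: "'a::field poly"
  assumes "irreducible p" "lead_coeff p = 1" "k > 0"
  shows "primary (p ^ k)" "lead_coeff (p ^ k) = 1"
  using assms degree_irreducible_pos[OF assms(1)]
  using degree_power_eq[of p k] by (force simp: primary_def lead_coeff_power)+

text \<open>The base of the power in \<open>primary\<close> need not be monic. Replacing it by its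
  monic associate introduces a constant \<open>a ^ k\<close>, which is 1 by comparison of leading
  coefficients.\<close>

lemma monic_primaryE:
  fixes g :: "'a::field poly"
  assumes "primary g" "lead_coeff g = 1"
  obtains p k where "irreducible p" "lead_coeff p = 1" "k > 0" "g = p ^ k"
    "Lambda g = degree p" "degree g = k * degree p"
proof -
  obtain p k where pk: "irreducible p" "g = p ^ k" "degree g > 0" using assms by (auto simp: primary_def)
  obtain r where r: "irreducible r" "lead_coeff r = 1" "r dvd p"
    using monic_irreducible_factor_exists degree_irreducible_pos[OF pk(1)] by blast
  then obtain c where c: "p = r * c" by (auto simp: dvd_def)
  have "is_unit c" using pk(1) r(1) c Factorial_Ring.irreducibleD irreducible_not_unit by blast
  then obtain a where a: "c = [:a:]" "a \<noteq> 0" by (elim is_unit_polyE) force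
  have g: "g = smult (a ^ k) (r ^ k)" using c a pk by (simp add: smult_power mult.commute)
  hence "a ^ k = 1" using assms(2) r(2) lead_coeff_power[of r k] a(2) by simp
  hence g': "g = r ^ k" using g by simp
  moreover have k: "k > 0" using pk(3) g' by (cases k) auto
  moreover have "degree g = k * degree r" using g' r(2) degree_power_eq[of r k] by fastforce
  ultimately show ?thesis using that[OF r(1,2)] Lambda_power[OF r(1,2) k] by simp
qed

lemma prime_power_dvd_mult:
  fixes r :: "'a::field poly"
  assumes "prime_elem r" "\<not> r dvd p" "r ^ k dvd p * h"
  shows "r ^ k dvd h"
  using assms(3)
proof (induction k arbitrary: h)
  case (Suc k)
  hence dvd: "r * r ^ k dvd p * h" by simp
  hence "r dvd p * h" by (rule dvd_mult_left)
  hence "r dvd h" using assms(1,2) by (simp add: prime_elem_dvd_mult_iff)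
  then obtain h' where h': "h = r * h'" by (auto simp: dvd_def)
  have "r * r ^ k dvd r * (p * h')" using dvd unfolding h' by (simp only: mult.left_commute)
  hence "r ^ k dvd p * h'" using assms(1) by (simp only: dvd_mult_cancel_left prime_elem_def) blast
  hence "r ^ k dvd h'" by (rule Suc.IH)
  thus ?case unfolding h' by simp
qed simp

text \<open>The number \<open>e\<close> is the multiplicity of \<open>p\<close> in \<open>h\<close>.
  Powers of irreducibles other than \<open>p\<close> divide \<open>p * h\<close> only if they divide
  \<open>h\<close>, so exactly the next power of \<open>p\<close> is new.\<close>

lemma primary_divisors_mult:
  fixes p h :: "'a::field poly"
  assumes "irreducible p" "lead_coeff p = 1" "h \<noteq> 0"
  obtains e where "primary_divisors (p * h) = insert (p ^ Suc e) (primary_divisors h)"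
    "p ^ Suc e \<notin> primary_divisors h"
proof -
  have p: "p \<noteq> 0" "degree p > 0" using assms degree_irreducible_pos by auto
  define P where "P = (\<lambda>n. \<not> p ^ n dvd h)"
  have "P (Suc (degree h))"
  proof -
    have "degree h < Suc (degree h) * 1" by simp
    also have "\<dots> \<le> Suc (degree h) * degree p" using p(2) by (intro mult_le_mono2) simp
    also have "\<dots> = degree (p ^ Suc (degree h))" by (simp only: degree_power_eq[OF p(1)])
    finally have "degree (p ^ Suc (degree h)) > degree h" .
    thus ?thesis using assms(3) dvd_imp_degree_le unfolding P_def by (metis leD)
  qed
  moreover have "\<not> P 0" by (simp add: P_def)
  ultimately obtain e where e: "\<not> P e" "P (Suc e)"
    using ex_least_nat_less[of P] by blast
  have e': "p ^ k dvd h \<longleftrightarrow> k \<le> e" for k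
  proof
    assume "p ^ k dvd h"
    hence "\<not> Suc e \<le> k" using e(2) unfolding P_def by (meson le_imp_power_dvd dvd_trans)
    thus "k \<le> e" by simp
  next
    assume "k \<le> e"
    thus "p ^ k dvd h" using e(1) unfolding P_def by (meson le_imp_power_dvd dvd_trans)
  qed
  show ?thesis
  proof
    show "p ^ Suc e \<notin> primary_divisors h" using e by (simp add: primary_divisors_def P_def)
    have "g \<in> insert (p ^ Suc e) (primary_divisors h)" if "g \<in> primary_divisors (p * h)" for g
    proof -
      have g: "primary g" "lead_coeff g = 1" "g dvd p * h" using that by (auto simp: primary_divisors_def)
      obtain r k where r: "irreducible r" "lead_coeff r = 1" "k > 0" "g = r ^ k"
        using monic_primaryE[OF g(1,2)] by metis
      show ?thesis
      proof (cases "r = p")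
        case False
        hence "\<not> r dvd p" using r assms monic_unique_irreducible_factor by blast
        hence "g dvd h" using prime_power_dvd_mult field_poly_irreducible_imp_prime r g(3) by blast
        thus ?thesis using g by (simp add: primary_divisors_def)
      next
        case True
        obtain k' where k': "k = Suc k'" using r(3) gr0_implies_Suc by blast
        have "p * p ^ k' dvd p * h" using g(3) unfolding r(4) True k' by simp
        hence "p ^ k' dvd h" using p(1) by (simp only: dvd_mult_cancel_left) simp
        hence "k' \<le> e" by (simp only: e')
        hence "k = Suc e \<or> k \<le> e" using k' by auto
        thus ?thesis
        proof
          assume "k = Suc e"
          thus ?thesis using r(4) True by simp
        next
          assume "k \<le> e"
          hence "g dvd h" unfolding r(4) True by (simp only: e')
          thus ?thesis using g by (simp add: primary_divisors_def)
        qed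
      qed
    qed
    moreover have "p ^ Suc e \<in> primary_divisors (p * h)"
      using monic_primary_power[OF assms(1,2), of "Suc e"] e(1)
      by (simp add: primary_divisors_def P_def mult_dvd_mono)
    moreover have "primary_divisors h \<subseteq> primary_divisors (p * h)"
      by (auto simp: primary_divisors_def)
    ultimately show "primary_divisors (p * h) = insert (p ^ Suc e) (primary_divisors h)" by blast
  qed
qed

text \<open>The analogue of the identity that the von Mangoldt function summed over the divisors of
  an integer gives its logarithm. Each irreducible factor split off adds one primary divisor,
  weighted by its degree.\<close>

lemma sum_Lambda_primary_divisors:
  fixes h :: "'a::field poly"
  assumes "lead_coeff h = 1"
  shows "finite (primary_divisors h) \<and> (\<Sum>g\<in>primary_divisors h. Lambda g) = degree h"
  using assms
proof (induction "degree h" arbitrary: h rule: less_induct)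
  case less
  show ?case
  proof (cases "degree h = 0")
    case True
    hence "h = 1" using less.prems by (auto elim!: degree_eq_zeroE)
    hence "primary_divisors h = {}"
      by (auto simp: primary_divisors_def primary_def is_unit_iff_degree)
         (metis degree_0 is_unit_iff_degree less_irrefl)
    thus ?thesis using True by simp
  next
    case False
    then obtain p where p: "irreducible p" "lead_coeff p = 1" "p dvd h"
      using monic_irreducible_factor_exists by blast
    then obtain h' where h': "h = p * h'" by (auto simp: dvd_def)
    have h0: "h' \<noteq> 0" "p \<noteq> 0" using h' False by auto
    have deg: "degree h = degree p + degree h'" using h' h0 by (simp add: degree_mult_eq)
    have IH: "finite (primary_divisors h')" "(\<Sum>g\<in>primary_divisors h'. Lambda g) = degree h'"
      using less.hyps[of h'] less.prems deg degree_irreducible_pos[OF p(1)] h' p(2)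
      by (auto simp: lead_coeff_mult)
    obtain e where e: "primary_divisors h = insert (p ^ Suc e) (primary_divisors h')"
        "p ^ Suc e \<notin> primary_divisors h'"
      using primary_divisors_mult[OF p(1,2) h0(1)] h' by metis
    show ?thesis using IH e deg Lambda_power[OF p(1,2), of "Suc e"] by simp
  qed
qed

section \<open>Logarithmic derivatives and power sums\<close>

text \<open>The coefficients of u L'(u) = L(u) * (sum of S_r u^r). The degree m of each
  \<open>h\<close> is written as the sum of \<open>Lambda\<close> over its primary divisors, and the
  pairs (h, g) are regrouped by g and the cofactor of g in h.\<close>

lemma euler_product_convolution:
  fixes c :: "'a::{field,finite} poly \<Rightarrow> complex"
  assumes mult: "\<And>g h. c (g * h) = c g * c h"
  shows "of_nat m * (\<Sum>h\<in>monics m. c h) =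
    (\<Sum>r=1..m. (\<Sum>g\<in>monic_primaries r. of_nat (Lambda g) * c g) * (\<Sum>h\<in>monics (m - r). c h))"
proof -
  have fin: "finite (primary_divisors h)" if "h \<in> monics m" for h
    using sum_Lambda_primary_divisors that by (auto simp: monics_def)
  have "of_nat m * (\<Sum>h\<in>monics m. c h) = (\<Sum>h\<in>monics m. \<Sum>g\<in>primary_divisors h. of_nat (Lambda g) * c h)"
    unfolding sum_distrib_left
  proof (intro sum.cong refl)
    fix h :: "'a poly" assume "h \<in> monics m"
    hence "m = (\<Sum>g\<in>primary_divisors h. Lambda g)"
      using sum_Lambda_primary_divisors[of h] by (auto simp: monics_def)
    thus "of_nat m * c h = (\<Sum>g\<in>primary_divisors h. of_nat (Lambda g) * c h)"
      by (simp flip: sum_distrib_right)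
  qed
  also have "\<dots> = (\<Sum>(h, g)\<in>Sigma (monics m) primary_divisors. of_nat (Lambda g) * c h)"
    using fin by (intro sum.Sigma finite_monics) auto
  also have "\<dots> = (\<Sum>(r, g, h)\<in>(SIGMA r:{1..m}. monic_primaries r \<times> monics (m - r)).
      of_nat (Lambda g) * c g * c h)"
  proof (rule sum.reindex_bij_witness[of _ "\<lambda>(r, g, h). (g * h, g)" "\<lambda>(h, g). (degree g, g, h div g)"])
    fix x :: "'a poly \<times> 'a poly" assume x: "x \<in> Sigma (monics m) primary_divisors"
    obtain h g where hg: "x = (h, g)" by (cases x)
    hence 1: "lead_coeff h = 1" "degree h = m" "lead_coeff g = 1" "primary g" "g dvd h"
      using x by (auto simp: monics_def primary_divisors_def)
    then obtain k where k: "h = g * k" by (auto simp: dvd_def)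
    have 2: "g \<noteq> 0" "k \<noteq> 0" using 1 k by auto
    have "lead_coeff k = 1" using 1 k by (simp add: lead_coeff_mult)
    moreover have "m = degree g + degree k" using 1 2 k by (simp add: degree_mult_eq)
    moreover have "degree g > 0" using 1 by (simp add: primary_def)
    ultimately show "(case case x of (h, g) \<Rightarrow> (degree g, g, h div g) of (r, g, h) \<Rightarrow> (g * h, g)) = x"
      "(case x of (h, g) \<Rightarrow> (degree g, g, h div g)) \<in> (SIGMA r:{1..m}. monic_primaries r \<times> monics (m - r))"
      "(case case x of (h, g) \<Rightarrow> (degree g, g, h div g) of (r, g, h) \<Rightarrow> of_nat (Lambda g) * c g * c h) =
        (case x of (h, g) \<Rightarrow> of_nat (Lambda g) * c h)"
      using 1 2 k mult by (auto simp: hg monics_def monic_primaries_def)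
  next
    fix y :: "nat \<times> 'a poly \<times> 'a poly"
    assume y: "y \<in> (SIGMA r:{1..m}. monic_primaries r \<times> monics (m - r))"
    obtain r g h where rgh: "y = (r, g, h)" by (cases y)
    have 1: "lead_coeff h = 1" "degree h = m - r" "lead_coeff g = 1" "degree g = r" "primary g" "r \<le> m"
      using y rgh by (auto simp: monics_def monic_primaries_def)
    hence 2: "g \<noteq> 0" "h \<noteq> 0" by auto
    have "degree (g * h) = m" using 1 2 by (simp add: degree_mult_eq)
    moreover have "lead_coeff (g * h) = 1" unfolding lead_coeff_mult using 1 by simp
    ultimately have "g * h \<in> monics m" unfolding monics_def by blast
    thus "(case case y of (r, g, h) \<Rightarrow> (g * h, g) of (h, g) \<Rightarrow> (degree g, g, h div g)) = y"
      "(case y of (r, g, h) \<Rightarrow> (g * h, g)) \<in> Sigma (monics m) primary_divisors"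
      using 1 2 by (auto simp: rgh primary_divisors_def)
  qed
  also have "\<dots> = (\<Sum>r=1..m. \<Sum>(g, h)\<in>monic_primaries r \<times> monics (m - r). of_nat (Lambda g) * c g * c h)"
    by (subst sum.Sigma) (auto simp: finite_monics finite_monic_primaries case_prod_unfold)
  also have "\<dots> = (\<Sum>r=1..m. (\<Sum>g\<in>monic_primaries r. of_nat (Lambda g) * c g) * (\<Sum>h\<in>monics (m - r). c h))"
    by (simp add: sum_product sum.cartesian_product)
  finally show ?thesis .
qed

text \<open>The exact form of the prime number theorem for polynomials. For the trivial weight, the
  convolution reads d * q^d on the left, and each of the d - 1 terms with r < d contributes q^d by
  induction, which leaves q^d for r = d.\<close>

lemma sum_Lambda_monic_primaries:
  assumes "d \<ge> 1"
  shows "(\<Sum>g\<in>(monic_primaries d :: 'a::{field,finite} poly set). Lambda g) = CARD('a) ^ d"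
  using assms
proof (induction d rule: less_induct)
  case (less d)
  define S where "S = (\<lambda>r. \<Sum>g\<in>(monic_primaries r :: 'a poly set). of_nat (Lambda g) :: complex)"
  define q :: complex where "q = of_nat CARD('a)"
  have S: "S r = q ^ r" if "1 \<le> r" "r < d" for r
  proof -
    have "S r = of_nat (\<Sum>g\<in>(monic_primaries r :: 'a poly set). Lambda g)" by (simp add: S_def)
    also have "(\<Sum>g\<in>(monic_primaries r :: 'a poly set). Lambda g) = CARD('a) ^ r"
      using that by (intro less.IH) auto
    finally show ?thesis by (simp add: q_def)
  qed
  have "of_nat d * q ^ d = (\<Sum>r=1..d. S r * q ^ (d - r))"
    using euler_product_convolution[of "\<lambda>_ :: 'a poly. 1" d]
    by (simp add: card_monics S_def q_def)
  also have "{1..d} = insert d {1..<d}" using less.prems by auto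
  also have "(\<Sum>r\<in>insert d {1..<d}. S r * q ^ (d - r)) = S d + (\<Sum>r=1..<d. q ^ d)"
    by (simp add: S flip: power_add)
  also have "(\<Sum>r=1..<d. q ^ d) = (of_nat d - 1) * q ^ d" using less.prems by (simp add: of_nat_diff)
  finally have "S d = q ^ d" by (simp add: algebra_simps)
  hence "of_nat (\<Sum>g\<in>(monic_primaries d :: 'a poly set). Lambda g) = (of_nat (CARD('a) ^ d) :: complex)"
    by (simp add: S_def q_def)
  thus ?case by (simp only: of_nat_eq_iff)
qed

text \<open>The logarithmic derivative is additive over the factors, and a factor 1 - w u
  contributes the geometric series of w u without its constant term, negated. The formula is kept
  free of division.\<close>

lemma fps_log_deriv_prod_linear:
  fixes ws :: "complex list"
  defines "L \<equiv> (\<Prod>w\<leftarrow>ws. 1 - fps_const w * fps_X)"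
  shows "fps_X * fps_deriv L = - Abs_fps (\<lambda>r. if r = 0 then 0 else \<Sum>w\<leftarrow>ws. w ^ r) * L"
  unfolding L_def
proof (induction ws)
  case (Cons w ws)
  define A where "A = 1 - fps_const w * fps_X"
  define B where "B = (\<Prod>w\<leftarrow>ws. 1 - fps_const w * fps_X)"
  define T where "T = Abs_fps (\<lambda>r. if r = 0 then 0 else w ^ r)"
  define U where "U = Abs_fps (\<lambda>r. if r = 0 then 0 else \<Sum>w\<leftarrow>ws. w ^ r)"
  have A: "fps_X * fps_deriv A = - T * A"
  proof (rule fps_ext)
    fix r
    show "fps_nth (fps_X * fps_deriv A) r = fps_nth (- T * A) r"
    proof (cases r)
      case 0
      thus ?thesis by (simp add: A_def T_def)
    next
      case (Suc r')
      have "fps_nth (T * A) r = fps_nth (T - fps_const w * (T * fps_X)) r" by (simp add: A_def algebra_simps)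
      also have "\<dots> = (if r' = 0 then w else 0)" by (cases r') (simp_all add: Suc T_def)
      finally show ?thesis by (simp add: Suc A_def)
    qed
  qed
  have TU: "Abs_fps (\<lambda>r. if r = 0 then 0 else \<Sum>w\<leftarrow>w # ws. w ^ r) = T + U"
    by (rule fps_ext) (auto simp: T_def U_def)
  have "fps_X * fps_deriv (A * B) = (fps_X * fps_deriv A) * B + A * (fps_X * fps_deriv B)"
    by (simp add: algebra_simps)
  also have "\<dots> = - (T + U) * (A * B)"
    unfolding A using Cons.IH by (simp add: B_def U_def algebra_simps)
  finally show ?case unfolding TU by (simp add: A_def B_def)
qed (auto simp: fps_eq_iff)

text \<open>The \<open>a m\<close> are the coefficients of a polynomial L of degree below
  \<open>n\<close>, and \<open>conv\<close> says that u L' is L times the generating series of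
  \<open>S\<close>. Factoring L over the complex numbers gives the same identity with negated power
  sums of the inverse roots, and L cancels.\<close>

lemma newton_identities_power_sums:
  fixes a S :: "nat \<Rightarrow> complex"
  assumes a0: "a 0 = 1" and an: "\<And>m. m \<ge> n \<Longrightarrow> a m = 0"
    and conv: "\<And>m. of_nat m * a m = (\<Sum>r=1..m. S r * a (m - r))"
  shows "\<exists>k w. k < n \<and> (\<forall>r\<ge>1. S r = - (\<Sum>i<k. w i ^ r))"
proof -
  have n: "n > 0" using a0 an[of 0] by (cases n) auto
  define P where "P = Poly (map a [0..<n])"
  have P: "coeff P m = a m" for m
    using an[of m] by (simp add: P_def coeff_Poly_eq nth_default_def)
  have P0: "P \<noteq> 0" using P[of 0] a0 by auto
  have deg: "degree P < n"
    using degree_le[of "n - 1" P] an n by (simp add: P)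
  obtain A where A: "size A = degree P" "P = smult (lead_coeff P) (\<Prod>x\<in>#A. [:-x, 1:])"
    using alg_closed_imp_factorization[OF P0] by auto
  obtain xs where xs: "mset xs = A" using ex_mset by blast
  have P_xs: "P = smult (lead_coeff P) (\<Prod>x\<leftarrow>xs. [:-x, 1:])"
    using A(2) by (simp flip: xs) (metis mset_map prod_mset_prod_list)
  have nz: "x \<noteq> 0" if "x \<in> set xs" for x
  proof
    assume "x = 0"
    hence "poly (\<Prod>x\<leftarrow>xs. [:-x, 1:]) 0 = 0"
      using that by (induction xs) auto
    hence "poly P 0 = 0" by (subst P_xs) simp
    thus False using P[of 0] a0 by (simp add: poly_0_coeff_0)
  qed
  define ws where "ws = map inverse xs"
  define L where "L = fps_of_poly P"
  \<comment> \<open>Each X - x is rewritten as a constant times 1 - X / x. The constants need not be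
    tracked, because they drop out of the logarithmic derivative.\<close>
  have ex: "\<exists>c. fps_of_poly (\<Prod>x\<leftarrow>xs. [:-x, 1:]) = fps_const c * (\<Prod>w\<leftarrow>map inverse xs. 1 - fps_const w * fps_X)"
    using nz
  proof (induction xs)
    case Nil show ?case by (intro exI[of _ 1]) simp
  next
    case (Cons x xs)
    then obtain c where c: "fps_of_poly (\<Prod>x\<leftarrow>xs. [:-x, 1:]) = fps_const c * (\<Prod>w\<leftarrow>map inverse xs. 1 - fps_const w * fps_X)"
      by auto
    have "fps_of_poly [:-x, 1:] = fps_const (-x) * (1 - fps_const (inverse x) * fps_X)"
      using Cons.prems by (intro fps_ext) (auto simp: coeff_pCons split: nat.splits)
    hence "fps_of_poly (\<Prod>x\<leftarrow>x # xs. [:-x, 1:]) =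
        fps_const (-x * c) * (\<Prod>w\<leftarrow>map inverse (x # xs). 1 - fps_const w * fps_X)"
      using c by (simp only: list.map prod_list.Cons fps_of_poly_mult mult_ac flip: fps_const_mult)
    thus ?case by blast
  qed
  then obtain c where c: "L = fps_const c * (\<Prod>w\<leftarrow>ws. 1 - fps_const w * fps_X)"
  proof -
    obtain c where "fps_of_poly (\<Prod>x\<leftarrow>xs. [:-x, 1:]) = fps_const c * (\<Prod>w\<leftarrow>ws. 1 - fps_const w * fps_X)"
      using ex by (auto simp: ws_def)
    moreover have "L = fps_const (lead_coeff P) * fps_of_poly (\<Prod>x\<leftarrow>xs. [:-x, 1:])"
      unfolding L_def by (subst P_xs) (rule fps_of_poly_smult)
    ultimately have "L = fps_const (lead_coeff P * c) * (\<Prod>w\<leftarrow>ws. 1 - fps_const w * fps_X)"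
      by (simp add: mult.assoc flip: fps_const_mult)
    thus ?thesis using that by blast
  qed
  define T where "T = Abs_fps (\<lambda>r. if r = 0 then 0 else \<Sum>w\<leftarrow>ws. w ^ r)"
  define S' where "S' = Abs_fps (\<lambda>r. if r = 0 then 0 else S r)"
  have "fps_X * fps_deriv L = - T * L"
  proof -
    let ?R = "\<Prod>w\<leftarrow>ws. 1 - fps_const w * fps_X"
    have "fps_X * fps_deriv L = fps_const c * (fps_X * fps_deriv ?R)"
      unfolding c by (simp only: fps_deriv_mult fps_deriv_const mult_zero_left add_0_right mult.left_commute)
    also have "\<dots> = - T * L"
      unfolding fps_log_deriv_prod_linear T_def c by (simp only: mult.left_commute mult_minus_left mult_minus_right)
    finally show ?thesis .
  qed
  moreover have "fps_X * fps_deriv L = S' * L"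
  proof (rule fps_ext)
    fix m
    have "fps_nth (S' * L) m = (\<Sum>i=0..m. fps_nth S' i * a (m - i))"
      by (simp add: fps_mult_nth L_def P)
    also have "\<dots> = (\<Sum>i=1..m. S i * a (m - i))"
      by (rule sum.mono_neutral_cong_right) (auto simp: S'_def)
    also have "\<dots> = of_nat m * a m" by (simp add: conv)
    also have "\<dots> = fps_nth (fps_X * fps_deriv L) m" by (cases m) (simp_all add: L_def P)
    finally show "fps_nth (fps_X * fps_deriv L) m = fps_nth (S' * L) m" by simp
  qed
  moreover have "L \<noteq> 0" using P0 by (simp add: L_def)
  ultimately have "S' = - T" using mult_right_cancel[of L "S'" "- T"] by simp
  show ?thesis
  proof (intro exI[of _ "length ws"] exI[of _ "\<lambda>i. ws ! i"] conjI allI impI)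
    show "length ws < n" using A(1) deg by (simp add: ws_def flip: xs)
    fix r :: nat assume r: "r \<ge> 1"
    have "S r = fps_nth S' r" using r by (simp add: S'_def)
    also have "\<dots> = - (\<Sum>w\<leftarrow>ws. w ^ r)" using r by (simp add: \<open>S' = - T\<close> T_def)
    also have "(\<Sum>w\<leftarrow>ws. w ^ r) = (\<Sum>i<length ws. (ws ! i) ^ r)"
      by (simp add: sum_list_sum_nth atLeast0LessThan)
    finally show "S r = - (\<Sum>i<length ws. (ws ! i) ^ r)" .
  qed
qed

section \<open>Frobenius and conjugates\<close>

text \<open>Multiplication by a non-zero \<open>x\<close> permutes the non-zero elements and so
  preserves their product.\<close>

lemma power_card_eq_self:
  fixes x :: "'a::{field,finite}"
  shows "x ^ CARD('a) = x"
proof (cases "x = 0")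
  case False
  have "(\<Prod>y\<in>UNIV-{0}. x * y) = (\<Prod>y\<in>UNIV-{0}. y)"
    by (rule prod.reindex_bij_witness[of _ "\<lambda>y. y / x" "\<lambda>y. x * y"]) (use False in auto)
  hence "x ^ (CARD('a) - 1) * \<Prod>(UNIV - {0 :: 'a}) = \<Prod>(UNIV - {0 :: 'a})"
    by (simp add: prod.distrib)
  moreover have "\<Prod>(UNIV - {0 :: 'a}) \<noteq> 0" by (simp add: prod_zero_iff)
  ultimately have "x ^ (CARD('a) - 1) = 1" by (metis mult_cancel_right1)
  hence "x * x ^ (CARD('a) - 1) = x" by simp
  thus ?thesis by (metis One_nat_def Suc_pred finite_UNIV_card_ge_0 finite power_Suc)
qed (simp add: power_0_left)

lemma card_field_gt_1: "CARD('a::{field,finite}) > 1"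
proof -
  have "card {0 :: 'a, 1} \<le> CARD('a)" by (intro card_mono) auto
  moreover have "card {0 :: 'a, 1} = 2" by simp
  ultimately show ?thesis by linarith
qed

lemma field_embedding_of_nat: "field_embedding j \<Longrightarrow> j (of_nat n) = of_nat n"
  by (induction n) (auto simp: field_embedding_0 field_embedding_def)

lemma field_embedding_power: "field_embedding j \<Longrightarrow> j (x ^ n) = j x ^ n"
  by (induction n) (auto simp: field_embedding_def)

lemma field_embedding_inj: "field_embedding j \<Longrightarrow> inj j"
proof (rule injI)
  fix x y assume j: "field_embedding j" and xy: "j x = j y"
  have "j x = j (x - y) + j y" using j by (metis field_embedding_def diff_add_cancel)
  hence "j (x - y) = 0" using xy by simp
  thus "x = y" using field_embedding_eq_0_iff[OF j] by simp
qed

lemma eval_at_1: "field_embedding j \<Longrightarrow> eval_at j x 1 = 1"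
  by (simp add: eval_at_def field_embedding_def)

lemma eval_at_power: "field_embedding j \<Longrightarrow> eval_at j x (p ^ k) = eval_at j x p ^ k"
  by (induction k) (simp_all add: eval_at_1 eval_at_mult)

text \<open>Every x satisfies (x + 1)^q = x + 1 and x^q = x, so the middle binomial terms form a
  polynomial of degree below q with q zeros. This avoids any appeal to q being a prime
  power.\<close>

lemma choose_card_eq_0:
  assumes "0 < i" "i < CARD('a)"
  shows "of_nat (CARD('a) choose i) = (0 :: 'a::{field,finite})"
proof -
  define q where "q = CARD('a)"
  define P where "P = (\<Sum>i\<in>{0<..<q}. monom (of_nat (q choose i) :: 'a) i)"
  have q: "q > 1" unfolding q_def by (rule card_field_gt_1)
  have "poly P x = 0" for x
  proof -
    have "x + 1 = (x + 1) ^ q" unfolding q_def by (rule power_card_eq_self[symmetric])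
    also have "\<dots> = (\<Sum>i\<le>q. of_nat (q choose i) * x ^ i)" by (simp add: binomial_ring)
    also have "{..q} = insert 0 (insert q {0<..<q})" using q by auto
    also have "(\<Sum>i\<in>\<dots>. of_nat (q choose i) * x ^ i) = 1 + (x ^ q + poly P x)"
      using q by (simp add: P_def poly_sum poly_monom)
    also have "x ^ q = x" unfolding q_def by (rule power_card_eq_self)
    finally show ?thesis by simp
  qed
  moreover have "degree P < q"
  proof -
    have "degree P \<le> q - 1" unfolding P_def
    proof (intro degree_sum_le)
      fix i assume "i \<in> {0<..<q}"
      thus "degree (monom (of_nat (q choose i) :: 'a) i) \<le> q - 1"
        by (intro order.trans[OF degree_monom_le]) auto
    qed auto
    thus ?thesis using q by linarith
  qed
  ultimately have "P = 0" using q by (intro poly_eqI_degree[of UNIV]) (auto simp: q_def)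
  hence "0 = coeff P i" by simp
  also have "coeff P i = of_nat (q choose i)"
    using assms by (simp add: P_def coeff_sum coeff_monom q_def)
  finally show ?thesis by (simp add: q_def)
qed

section \<open>Irreducible polynomials as products over Frobenius orbits\<close>

locale finite_field_embedding =
  fixes j :: "'a::{field,finite} \<Rightarrow> 'k::field" and q :: nat
  assumes emb: "field_embedding j" and q_eq: "q = CARD('a)"
begin

lemma q_gt_1: "q > 1"
  unfolding q_eq by (rule card_field_gt_1)

lemma q_pos [simp]: "q > 0"
  using q_gt_1 by simp

lemma frobenius_add: "((x :: 'k) + y) ^ (q ^ i) = x ^ (q ^ i) + y ^ (q ^ i)"
proof (induction i)
  case (Suc i)
  have add: "(x + y) ^ q = x ^ q + y ^ q" for x y :: 'k
  proof -
    have q: "q > 1" by (rule q_gt_1)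
    have "(x + y) ^ q = (\<Sum>i\<le>q. of_nat (q choose i) * x ^ i * y ^ (q - i))"
      by (rule binomial_ring)
    also have "\<dots> = (\<Sum>i\<in>{0, q}. of_nat (q choose i) * x ^ i * y ^ (q - i))"
    proof (intro sum.mono_neutral_right ballI)
      fix i assume i: "i \<in> {..q} - {0, q}"
      have "(of_nat (q choose i) :: 'k) = j (of_nat (q choose i))"
        by (simp add: field_embedding_of_nat[OF emb])
      also have "(of_nat (q choose i) :: 'a) = 0" using i unfolding q_eq by (intro choose_card_eq_0) auto
      finally show "of_nat (q choose i) * x ^ i * y ^ (q - i) = 0"
        by (simp add: field_embedding_0[OF emb])
    qed auto
    finally show ?thesis using q by (simp add: add.commute)
  qed
  have "(x + y) ^ (q ^ Suc i) = ((x + y) ^ (q ^ i)) ^ q" by (simp add: mult.commute flip: power_mult)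
  also have "\<dots> = x ^ (q ^ Suc i) + y ^ (q ^ Suc i)"
    unfolding Suc add by (simp add: mult.commute flip: power_mult)
  finally show ?case .
qed simp

lemma frobenius_diff: "((x :: 'k) - y) ^ (q ^ i) = x ^ (q ^ i) - y ^ (q ^ i)"
  using frobenius_add[of "x - y" y i] by simp

lemma frobenius_inject: "(x :: 'k) ^ (q ^ i) = y ^ (q ^ i) \<Longrightarrow> x = y"
  using frobenius_diff[of x y i] by simp

lemma frobenius_embedding: "j c ^ (q ^ i) = j c"
proof (induction i)
  case (Suc i)
  have "j c ^ (q ^ Suc i) = (j c ^ (q ^ i)) ^ q" by (simp add: mult.commute flip: power_mult)
  thus ?case using Suc by (simp add: q_eq power_card_eq_self flip: field_embedding_power[OF emb])
qed simp

lemma frobenius_eval_at: "eval_at j x h ^ (q ^ i) = eval_at j (x ^ (q ^ i)) h"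
proof (induction h)
  case 0
  show ?case by (simp add: eval_at_0 power_0_left)
next
  case (pCons c h)
  thus ?case
    by (simp add: eval_at_pCons[OF emb] frobenius_add power_mult_distrib frobenius_embedding)
qed

text \<open>If the \<open>i\<close>-th Frobenius power fixes \<open>b\<close>, it fixes every
  polynomial expression in \<open>b\<close>. Those of degree below \<open>degree p\<close> are
  q^(degree p) distinct values, all roots of a polynomial of degree q^i.\<close>

lemma frobenius_period:
  assumes p: "irreducible p" "eval_at j b p = 0" and b: "b ^ (q ^ i) = b" "i > 0"
  shows "degree p \<le> i"
proof -
  have q1: "q > 1" by (rule q_gt_1)
  let ?T = "monom 1 (q ^ i) - monom 1 1 :: 'k poly"
  have qi: "q ^ i > 1" by (rule one_less_power[OF q1 b(2)])
  have "coeff ?T (q ^ i) = 1" using qi by simp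
  hence T0: "?T \<noteq> 0" by (metis coeff_0 zero_neq_one)
  have T: "poly ?T x = 0 \<longleftrightarrow> x ^ (q ^ i) = x" for x by (simp add: poly_monom)
  have inj: "inj_on (eval_at j b) (small_polys (degree p))"
  proof (rule inj_onI, rule ccontr)
    fix g h :: "'a poly"
    assume gh: "g \<in> small_polys (degree p)" "h \<in> small_polys (degree p)"
      "eval_at j b g = eval_at j b h" "g \<noteq> h"
    have "g - h \<in> small_polys (degree p)" using gh by (simp add: small_polys_def)
    hence "degree (g - h) < degree p" using gh(4) by (simp add: small_polys_iff)
    hence "eval_at j b (g - h) \<noteq> 0" using gh(4) by (intro eval_at_nonzero[OF emb p]) auto
    thus False using gh(3) by (simp add: eval_at_diff[OF emb])
  qed
  have "eval_at j b ` small_polys (degree p) \<subseteq> {x. poly ?T x = 0}"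
    unfolding T using frobenius_eval_at[of b _ i] b(1) by auto
  hence "card (eval_at j b ` (small_polys (degree p) :: 'a poly set)) \<le> card {x. poly ?T x = 0}"
    by (intro card_mono poly_roots_finite T0)
  also have "\<dots> \<le> degree ?T" by (rule card_poly_roots_bound[OF T0])
  also have "\<dots> \<le> q ^ i" using qi by (intro degree_diff_le) (auto simp: degree_monom_le intro: order.trans[OF degree_monom_le])
  finally have "q ^ degree p \<le> q ^ i" by (simp add: card_image[OF inj] card_small_polys q_eq)
  thus ?thesis using q1 by (simp add: power_increasing_iff)
qed

lemma inj_on_conjugates:
  assumes p: "irreducible p" "eval_at j b p = 0"
  shows "inj_on (\<lambda>i. b ^ (q ^ i)) {..<degree p}"
proof -
  have "b ^ (q ^ i) \<noteq> b ^ (q ^ k)" if "i < k" "k < degree p" for i k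
  proof
    assume "b ^ (q ^ i) = b ^ (q ^ k)"
    also have "q ^ k = q ^ (k - i) * q ^ i" using that by (simp flip: power_add)
    also have "b ^ \<dots> = (b ^ (q ^ (k - i))) ^ (q ^ i)" by (rule power_mult)
    finally have "b ^ (q ^ (k - i)) = b" using frobenius_inject by metis
    from frobenius_period[OF p this] that show False by simp
  qed
  thus ?thesis by (metis (no_types, lifting) inj_onI lessThan_iff nat_neq_iff)
qed

text \<open>Both sides are monic of degree \<open>degree p\<close> and vanish at the
  \<open>degree p\<close> distinct conjugates of \<open>b\<close>.\<close>

lemma map_poly_eq_prod_conjugates:
  assumes p: "irreducible p" "lead_coeff p = 1" "eval_at j b p = 0"
  shows "map_poly j p = (\<Prod>i<degree p. [:- (b ^ (q ^ i)), 1:])"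
proof (rule poly_eqI_degree_lead_coeff[of _ "degree p" _ "(\<lambda>i. b ^ (q ^ i)) ` {..<degree p}"])
  let ?P = "\<Prod>i<degree p. [:- (b ^ (q ^ i)), 1:]"
  have deg: "degree ?P = degree p" by (subst degree_prod_eq_sum_degree) auto
  have "lead_coeff ?P = 1" by (subst lead_coeff_prod) auto
  thus "coeff (map_poly j p) (degree p) = coeff ?P (degree p)"
    using p(2) deg emb by (simp add: coeff_map_poly field_embedding_0 field_embedding_def)
  show "degree ?P \<le> degree p" using deg by simp
  show "degree (map_poly j p) \<le> degree p" by (intro degree_le) (simp add: coeff_map_poly field_embedding_0[OF emb] coeff_eq_0)
  show "degree p \<le> card ((\<lambda>i. b ^ (q ^ i)) ` {..<degree p})"
    by (simp add: card_image[OF inj_on_conjugates[OF p(1,3)]])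
next
  fix z assume "z \<in> (\<lambda>i. b ^ (q ^ i)) ` {..<degree p}"
  then obtain i where i: "i < degree p" "z = b ^ (q ^ i)" by auto
  have "poly (map_poly j p) z = eval_at j b p ^ (q ^ i)"
    unfolding frobenius_eval_at i(2) by (simp add: eval_at_def)
  moreover have "poly (\<Prod>i<degree p. [:- (b ^ (q ^ i)), 1:]) z = 0"
    using i by (auto simp: poly_prod)
  ultimately show "poly (map_poly j p) z = poly (\<Prod>i<degree p. [:- (b ^ (q ^ i)), 1:]) z"
    using p(3) by (simp add: power_0_left)
qed

lemma eval_at_eq_prod_conjugates:
  assumes "irreducible p" "lead_coeff p = 1" "eval_at j b p = 0"
  shows "eval_at j x p = (\<Prod>i<degree p. x - b ^ (q ^ i))"
  unfolding eval_at_def map_poly_eq_prod_conjugates[OF assms] by (simp add: poly_prod)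

lemma roots_eq_conjugates:
  assumes "irreducible p" "lead_coeff p = 1" "eval_at j b p = 0"
  shows "{x. eval_at j x p = 0} = (\<lambda>i. b ^ (q ^ i)) ` {..<degree p}"
  unfolding eval_at_eq_prod_conjugates[OF assms] by auto

text \<open>The Frobenius image in question is again a root, hence one of the listed conjugates, say
  the one with index i. Cancelling i Frobenius steps leaves the period \<open>degree p - i\<close>,
  and minimality of the period forces i = 0.\<close>

lemma root_power_degree:
  assumes p: "irreducible p" "lead_coeff p = 1" "eval_at j b p = 0"
  shows "b ^ (q ^ degree p) = b"
proof -
  have "eval_at j (b ^ (q ^ degree p)) p = 0"
    using p(3) by (simp add: power_0_left flip: frobenius_eval_at)
  then obtain i where i: "i < degree p" "b ^ (q ^ degree p) = b ^ (q ^ i)"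
    using roots_eq_conjugates[OF p] by blast
  have "q ^ degree p = q ^ (degree p - i) * q ^ i" using i by (simp flip: power_add)
  hence "(b ^ (q ^ (degree p - i))) ^ (q ^ i) = b ^ (q ^ i)" using i(2) by (simp flip: power_mult)
  hence b: "b ^ (q ^ (degree p - i)) = b" by (rule frobenius_inject)
  have "degree p \<le> degree p - i" using i by (intro frobenius_period[OF p(1,3) b]) auto
  hence "i = 0" using i by linarith
  thus ?thesis using b by simp
qed

text \<open>Both degrees equal the exact Frobenius period of \<open>b\<close>, so both polynomials
  are the same product over its conjugates.\<close>

lemma monic_irreducible_eqI:
  assumes p: "irreducible p" "lead_coeff p = 1" "eval_at j b p = 0"
    and r: "irreducible r" "lead_coeff r = 1" "eval_at j b r = 0"
  shows "p = r"
proof -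
  have "degree p > 0" "degree r > 0" using p r degree_irreducible_pos by auto
  hence "degree p = degree r"
    using frobenius_period[OF p(1,3) root_power_degree[OF r]]
      frobenius_period[OF r(1,3) root_power_degree[OF p]] by simp
  hence "map_poly j p = map_poly j r"
    by (simp add: map_poly_eq_prod_conjugates[OF p] map_poly_eq_prod_conjugates[OF r])
  thus ?thesis
    using field_embedding_inj[OF emb] field_embedding_0[OF emb]
    by (metis coeff_map_poly injD poly_eqI)
qed

lemma frobenius_iterate: "(b :: 'k) ^ (q ^ i) = b \<Longrightarrow> b ^ (q ^ (i * k)) = b"
  by (induction k) (simp_all add: power_add power_mult)

text \<open>For \<open>b\<close> a root of an irreducible p of degree \<open>i\<close>, this passes
  from p to its power p^k.\<close>

lemma prod_conjugates_periodic:
  assumes b: "b ^ (q ^ i) = (b :: 'k)"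
  shows "(\<Prod>l<k * i. x - b ^ (q ^ l)) = (\<Prod>l<i. x - b ^ (q ^ l)) ^ k"
proof -
  have "(\<Prod>l<k * i. x - b ^ (q ^ l)) = (\<Prod>m<k. \<Prod>l\<in>{m * i..<m * i + i}. x - b ^ (q ^ l))"
    by (rule prod.nat_group[symmetric])
  also have "\<dots> = (\<Prod>m<k. \<Prod>l<i. x - b ^ (q ^ l))"
  proof (rule prod.cong[OF refl])
    fix m
    have "(\<Prod>l\<in>{m * i..<m * i + i}. x - b ^ (q ^ l)) = (\<Prod>l<i. x - b ^ (q ^ (m * i + l)))"
      by (rule prod.reindex_bij_witness[of _ "\<lambda>l. m * i + l" "\<lambda>l. l - m * i"]) auto
    also have "\<dots> = (\<Prod>l<i. x - b ^ (q ^ l))"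
    proof (rule prod.cong[OF refl])
      fix l
      have "b ^ (q ^ (m * i + l)) = (b ^ (q ^ (i * m))) ^ (q ^ l)"
        by (simp only: power_add power_mult mult.commute[of i m])
      thus "x - b ^ (q ^ (m * i + l)) = x - b ^ (q ^ l)" by (simp only: frobenius_iterate[OF b])
    qed
    finally show "(\<Prod>l\<in>{m * i..<m * i + i}. x - b ^ (q ^ l)) = (\<Prod>l<i. x - b ^ (q ^ l))" .
  qed
  finally show ?thesis by simp
qed

end

section \<open>Counting primary polynomials by their roots\<close>

text \<open>A polynomial g = p^k of degree \<open>r\<close> has exactly \<open>Lambda g\<close>
  distinct roots. They are fixed by the \<open>r\<close>-th Frobenius power because degree p divides
  \<open>r\<close>, and the product over their first \<open>r\<close> conjugates is g(x). A root
  determines p, and then \<open>r\<close> determines k, so distinct g have disjoint root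
  sets.\<close>

lemma sum_Lambda_le_card_conjugate_norm:
  fixes j :: "'a::{field,finite} \<Rightarrow> 'k::alg_closed_field"
  assumes emb: "field_embedding j"
    and fin: "finite {b. b ^ (CARD('a) ^ r) = b \<and> (\<Prod>i<r. x - b ^ (CARD('a) ^ i)) = z}"
  shows "(\<Sum>g | g \<in> monic_primaries r \<and> eval_at j x g = z. Lambda g) \<le>
    card {b. b ^ (CARD('a) ^ r) = b \<and> (\<Prod>i<r. x - b ^ (CARD('a) ^ i)) = z}"
proof -
  define q where "q = CARD('a)"
  interpret finite_field_embedding j q by unfold_locales (auto simp: emb q_def)
  let ?B = "{b. b ^ (q ^ r) = b \<and> (\<Prod>i<r. x - b ^ (q ^ i)) = z}"
  let ?P = "{g \<in> monic_primaries r. eval_at j x g = z}"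
  define Z where "Z = (\<lambda>g :: 'a poly. {b. eval_at j b g = 0})"
  have Z: "card (Z g) = Lambda g \<and> finite (Z g) \<and> Z g \<subseteq> ?B" if "g \<in> ?P" for g
  proof -
    have g: "primary g" "lead_coeff g = 1" "degree g = r" "eval_at j x g = z"
      using that by (auto simp: monic_primaries_def)
    obtain p k where p: "irreducible p" "lead_coeff p = 1" "k > 0" "g = p ^ k"
      "Lambda g = degree p" "degree g = k * degree p"
      using monic_primaryE[OF g(1,2)] .
    have "degree (map_poly j p) = degree p"
      by (intro degree_map_poly) (simp add: field_embedding_eq_0_iff[OF emb])
    hence "degree (map_poly j p) > 0" using degree_irreducible_pos[OF p(1)] by simp
    then obtain b where b: "eval_at j b p = 0"
      unfolding eval_at_def using alg_closed_imp_poly_has_root by blast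
    have Zg: "Z g = {b. eval_at j b p = 0}"
      using p(3) by (auto simp: Z_def p(4) eval_at_power[OF emb])
    have "Z g \<subseteq> ?B"
    proof
      fix c assume "c \<in> Z g"
      hence c: "eval_at j c p = 0" using Zg by simp
      have per: "c ^ (q ^ degree p) = c" by (rule root_power_degree[OF p(1,2) c])
      have "c ^ (q ^ r) = c"
        using frobenius_iterate[OF per, of k] g(3) p(6) by (simp add: mult.commute)
      moreover have "(\<Prod>i<r. x - c ^ (q ^ i)) = z"
        using prod_conjugates_periodic[OF per, of x k] g(3,4) p(4,6)
        by (simp add: eval_at_power[OF emb] eval_at_eq_prod_conjugates[OF p(1,2) c])
      ultimately show "c \<in> ?B" by simp
    qed
    thus ?thesis
      using inj_on_conjugates[OF p(1) b]
      by (simp add: Zg roots_eq_conjugates[OF p(1,2) b] card_image p(5))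
  qed
  have disj: "Z g \<inter> Z h = {}" if gh: "g \<in> ?P" "h \<in> ?P" "g \<noteq> h" for g h
  proof (rule ccontr)
    assume "Z g \<inter> Z h \<noteq> {}"
    then obtain b where b: "eval_at j b g = 0" "eval_at j b h = 0" by (auto simp: Z_def)
    have gh': "primary g" "lead_coeff g = 1" "degree g = r" "primary h" "lead_coeff h = 1" "degree h = r"
      using gh by (auto simp: monic_primaries_def)
    obtain p k where p: "irreducible p" "lead_coeff p = 1" "k > 0" "g = p ^ k"
      "Lambda g = degree p" "degree g = k * degree p"
      using monic_primaryE[OF gh'(1,2)] .
    obtain p' k' where p': "irreducible p'" "lead_coeff p' = 1" "k' > 0" "h = p' ^ k'"
      "Lambda h = degree p'" "degree h = k' * degree p'"
      using monic_primaryE[OF gh'(4,5)] .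
    have "eval_at j b p = 0" "eval_at j b p' = 0"
      using b p(3,4) p'(3,4) by (auto simp: eval_at_power[OF emb])
    hence "p = p'" by (intro monic_irreducible_eqI[of p b p'] p p')
    moreover from this have "k = k'"
      using gh'(3,6) p(6) p'(6) degree_irreducible_pos[OF p(1)] mult_cancel2[of k "degree p" k'] by simp
    ultimately show False using gh(3) p(4) p'(4) by simp
  qed
  have "(\<Sum>g\<in>?P. Lambda g) = (\<Sum>g\<in>?P. card (Z g))" using Z by (intro sum.cong) auto
  also have "\<dots> = card (\<Union>g\<in>?P. Z g)"
  proof (rule card_UN_disjoint[symmetric])
    show "finite ?P" by (rule finite_subset[OF _ finite_monic_primaries[of r]]) auto
  qed (use Z disj in blast)+
  also have "\<dots> \<le> card ?B" using Z by (intro card_mono fin[folded q_def]) blast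
  finally show ?thesis by (simp only: q_def)
qed

section \<open>The product over conjugates as a power of a fixed polynomial\<close>

lemma geometric_sum_nat: "(x :: nat) > 0 \<Longrightarrow> (\<Sum>i<t. x ^ i) * (x - 1) + 1 = x ^ t"
proof (induction t)
  case (Suc t)
  have "(\<Sum>i<Suc t. x ^ i) * (x - 1) + 1 = x ^ t + x ^ t * (x - 1)"
    using Suc by (simp add: add_mult_distrib)
  also have "\<dots> = x ^ Suc t" using Suc.prems by (cases x) simp_all
  finally show ?case .
qed simp

lemma geometric_sum_double_nat:
  "(\<Sum>i<t. (x :: nat) ^ i) * (x ^ t + 1) = (\<Sum>i<2 * t. x ^ i)"
proof -
  have "(\<Sum>i<k. x ^ i) * x ^ t + (\<Sum>i<t. x ^ i) = (\<Sum>i<t + k. x ^ i)" for k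
    by (induction k) (simp_all add: power_add algebra_simps)
  from this[of t] show ?thesis unfolding mult_2 by (simp add: distrib_left add.commute)
qed

context finite_field_embedding
begin

text \<open>As \<open>a\<close> has period \<open>n\<close>, it is the q^(l n + i)-th power of
  a^(q^(n - i)), so the factor with index l n + i is the q^(l n + i)-th power of a^(q^(n - i)) - b.
  The \<open>l\<close>-th block of \<open>n\<close> factors is thus the q^(n l)-th power of the
  first block.\<close>

lemma conjugate_norm_eq_power:
  assumes a: "a ^ (q ^ n) = (a :: 'k)"
  shows "(\<Prod>i<k * n. a - b ^ (q ^ i)) = (\<Prod>i<n. (a ^ (q ^ (n - i)) - b) ^ (q ^ i)) ^ (\<Sum>l<k. (q ^ n) ^ l)"
proof -
  have "(\<Prod>i<k * n. a - b ^ (q ^ i)) = (\<Prod>l<k. \<Prod>i\<in>{l * n..<l * n + n}. a - b ^ (q ^ i))"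
    by (rule prod.nat_group[symmetric])
  also have "\<dots> = (\<Prod>l<k. (\<Prod>i<n. (a ^ (q ^ (n - i)) - b) ^ (q ^ i)) ^ ((q ^ n) ^ l))"
  proof (rule prod.cong[OF refl])
    fix l
    have "(\<Prod>i\<in>{l * n..<l * n + n}. a - b ^ (q ^ i)) = (\<Prod>i<n. a - b ^ (q ^ (l * n + i)))"
      by (rule prod.reindex_bij_witness[of _ "\<lambda>i. l * n + i" "\<lambda>i. i - l * n"]) auto
    also have "\<dots> = (\<Prod>i<n. ((a ^ (q ^ (n - i)) - b) ^ (q ^ i)) ^ ((q ^ n) ^ l))"
    proof (rule prod.cong[OF refl])
      fix i assume "i \<in> {..<n}"
      hence e: "(n - i) + (l * n + i) = n * Suc l" by simp
      have "((a ^ (q ^ (n - i)) - b) ^ (q ^ i)) ^ ((q ^ n) ^ l) = (a ^ (q ^ (n - i)) - b) ^ (q ^ (l * n + i))"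
        by (simp add: power_add mult_ac flip: power_mult)
      also have "\<dots> = a ^ (q ^ ((n - i) + (l * n + i))) - b ^ (q ^ (l * n + i))"
        unfolding frobenius_diff by (simp only: power_add power_mult)
      also have "\<dots> = a - b ^ (q ^ (l * n + i))" unfolding e frobenius_iterate[OF a] ..
      finally show "a - b ^ (q ^ (l * n + i)) = ((a ^ (q ^ (n - i)) - b) ^ (q ^ i)) ^ ((q ^ n) ^ l)" ..
    qed
    finally show "(\<Prod>i\<in>{l * n..<l * n + n}. a - b ^ (q ^ i)) =
      (\<Prod>i<n. (a ^ (q ^ (n - i)) - b) ^ (q ^ i)) ^ ((q ^ n) ^ l)"
      by (simp only: prod_power_distrib)
  qed
  also have "\<dots> = (\<Prod>i<n. (a ^ (q ^ (n - i)) - b) ^ (q ^ i)) ^ (\<Sum>l<k. (q ^ n) ^ l)"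
    by (rule power_sum[symmetric])
  finally show ?thesis .
qed

end

text \<open>The polynomial method is applied to x = b - a with m = q^(n t) and s = q^n - 1. In
  \<open>G\<close> the factor with index 0 becomes -x because \<open>a\<close> has period
  \<open>n\<close>, and the others are non-zero at 0 because no smaller period exists.
  \<open>D\<close> is the degree of \<open>G\<close> and depends on neither t nor z.\<close>

lemma card_conjugate_norm_bound:
  fixes j :: "'a::{field,finite} \<Rightarrow> 'k::alg_closed_field" and a :: 'k
  defines "q \<equiv> CARD('a)"
  assumes emb: "field_embedding j" and n: "n > 0"
    and a: "a ^ (q ^ n) = a" "\<forall>i\<in>{0<..<n}. a ^ (q ^ i) \<noteq> a"
  shows "\<exists>D. \<forall>t\<ge>2 * D + 7. \<forall>z. z \<noteq> 0 \<longrightarrow>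
    finite {b. b ^ (q ^ (2 * t * n)) = b \<and> (\<Prod>i<2 * t * n. a - b ^ (q ^ i)) = z} \<and>
    (q ^ n - 1) * card {b. b ^ (q ^ (2 * t * n)) = b \<and> (\<Prod>i<2 * t * n. a - b ^ (q ^ i)) = z}
      \<le> (q ^ (n * t)) ^ 2 + q ^ (n * t) * (q ^ n - 1) * (2 * D + 3)"
proof -
  interpret finite_field_embedding j q by unfold_locales (auto simp: emb q_def)
  define h where "h = (\<lambda>i. [:a ^ (q ^ (n - i)) - a, -1:] ^ (q ^ i))"
  define G where "G = (\<Prod>i<n. h i)"
  define U where "U = [:-1:] * (\<Prod>i\<in>{1..<n}. h i)"
  have G: "G = [:0, 1:] * U"
  proof -
    have "{..<n} = insert 0 {1..<n}" using n by auto
    thus ?thesis by (simp add: G_def U_def h_def a(1))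
  qed
  have U0: "poly U 0 \<noteq> 0"
    using a(2) by (auto simp: U_def h_def poly_prod)
  define D where "D = degree G"
  show ?thesis
  proof (intro exI[of _ D] allI impI)
    fix t and z :: 'k
    assume t: "t \<ge> 2 * D + 7" and z: "z \<noteq> 0"
    define B where "B = {b. b ^ (q ^ (2 * t * n)) = b \<and> (\<Prod>i<2 * t * n. a - b ^ (q ^ i)) = z}"
    define m where "m = q ^ (n * t)"
    define u where "u = (\<Sum>i<t. (q ^ n) ^ i)"
    have m: "m = u * (q ^ n - 1) + 1"
      using geometric_sum_nat[of "q ^ n" t] by (simp add: m_def u_def power_mult)
    have w: "u * (m + 1) = (\<Sum>i<2 * t. (q ^ n) ^ i)"
      unfolding u_def m_def power_mult by (rule geometric_sum_double_nat)
    have m2: "m ^ 2 = q ^ (2 * t * n)" by (simp add: m_def mult_ac flip: power_mult)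
    have "t < 2 ^ t" by (rule less_exp)
    also have "2 ^ t \<le> q ^ t" using q_gt_1 by (intro power_mono) auto
    also have "q ^ t \<le> m" unfolding m_def using q_gt_1 n by (intro power_increasing) auto
    finally have mD: "m > 2 * degree G + 6" using t by (simp add: D_def)
    have u: "u > 0" using t unfolding u_def by (intro sum_pos2[of _ 0]) auto
    have inj: "inj_on (\<lambda>b. b - a) B" by (auto simp: inj_on_def)
    have "finite ((\<lambda>b. b - a) ` B) \<and> (q ^ n - 1) * card ((\<lambda>b. b - a) ` B) \<le>
        m ^ 2 + m * (q ^ n - 1) * (2 * degree G + 3)"
    proof (rule stepanov_bound[of m G U u "q ^ n - 1" z])
      fix x assume "x \<in> (\<lambda>b. b - a) ` B"
      then obtain b where b: "x = b - a" "b ^ (q ^ (2 * t * n)) = b" "(\<Prod>i<2 * t * n. a - b ^ (q ^ i)) = z"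
        by (auto simp: B_def)
      have "a ^ (q ^ (2 * t * n)) = a"
        using frobenius_iterate[OF a(1), of "2 * t"] by (simp add: mult.commute)
      hence "x ^ (m ^ 2) = x" unfolding m2 b(1) frobenius_diff using b(2) by simp
      moreover have "poly G x ^ (u * (m + 1)) = z"
      proof -
        have "poly G x = (\<Prod>i<n. (a ^ (q ^ (n - i)) - b) ^ (q ^ i))"
          by (simp add: G_def h_def poly_prod b(1))
        thus ?thesis
          unfolding w b(3)[symmetric] conjugate_norm_eq_power[OF a(1)] by simp
      qed
      ultimately show "x ^ (m ^ 2) = x \<and> poly G x ^ (u * (m + 1)) = z" ..
    next
      show "(x + y) ^ m = x ^ m + y ^ m" for x y :: 'k unfolding m_def by (rule frobenius_add)
    qed (fact G U0 m u mD z)+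
    hence "finite B \<and> (q ^ n - 1) * card B \<le> m ^ 2 + m * (q ^ n - 1) * (2 * degree G + 3)"
      using finite_imageD[OF _ inj] by (auto simp: card_image[OF inj])
    thus "finite {b. b ^ (q ^ (2 * t * n)) = b \<and> (\<Prod>i<2 * t * n. a - b ^ (q ^ i)) = z} \<and>
      (q ^ n - 1) * card {b. b ^ (q ^ (2 * t * n)) = b \<and> (\<Prod>i<2 * t * n. a - b ^ (q ^ i)) = z}
      \<le> (q ^ (n * t)) ^ 2 + q ^ (n * t) * (q ^ n - 1) * (2 * D + 3)"
      by (simp only: B_def m_def D_def)
  qed
qed

section \<open>The Weil bound\<close>

lemma mult_character_1:
  assumes "mult_character \<psi>"
  shows "\<psi> 1 = 1"
proof -
  have "1 \<in> mult_group" by (simp add: mult_group_def)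
  hence "\<psi> (1 * 1) = \<psi> 1 * \<psi> 1" "\<psi> 1 \<noteq> 0"
    using assms unfolding mult_character_def by blast+
  thus ?thesis by simp
qed

lemma mult_character_power:
  assumes "mult_character \<psi>" "x \<noteq> 0"
  shows "\<psi> (x ^ k) = \<psi> x ^ k"
  using assms by (induction k) (auto simp: mult_character_1 mult_character_def mult_group_def)

lemma power_card_minus_1:
  fixes x :: "'a::{field,finite}"
  assumes "x \<noteq> 0"
  shows "x ^ (CARD('a) - 1) = 1"
proof -
  have "Suc (CARD('a) - 1) = CARD('a)" using card_field_gt_1[where 'a = 'a] by linarith
  hence "x * x ^ (CARD('a) - 1) = x * 1"
    using power_card_eq_self[of x] by (metis mult_1_right power_Suc)
  thus ?thesis using assms by (simp only: mult_cancel_left) simp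
qed

text \<open>The values are roots of unity, since the group is finite.\<close>

lemma norm_mult_character:
  fixes x :: "'b::{field,finite}"
  assumes "mult_character \<psi>" "x \<noteq> 0"
  shows "cmod (\<psi> x) = 1"
proof -
  have "\<psi> x ^ (CARD('b) - 1) = 1"
    using mult_character_power[OF assms, of "CARD('b) - 1"]
    unfolding power_card_minus_1[OF assms(2)] mult_character_1[OF assms(1)] by simp
  hence "cmod (\<psi> x) ^ (CARD('b) - 1) = 1" by (metis norm_one norm_power)
  thus ?thesis
    using card_field_gt_1[where 'a = 'b] by (intro power_eq_imp_eq_base[of _ "CARD('b) - 1" 1]) simp_all
qed

section \<open>The L-function of a non-trivial character\<close>

locale nontrivial_character_sum =
  fixes \<iota> :: "'a::{field,finite} \<Rightarrow> 'b::{field,finite}" and \<alpha> :: 'b and f :: "'a poly"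
    and n q :: nat and \<psi> :: "'b \<Rightarrow> complex"
  assumes iota: "field_embedding \<iota>" and card_a: "q = CARD('a)" and card_b: "CARD('b) = q ^ n"
    and f: "irreducible f" "degree f = n" "eval_at \<iota> \<alpha> f = 0"
    and chi: "mult_character \<psi>" and nontrivial: "\<exists>x. x \<noteq> 0 \<and> \<psi> x \<noteq> 1"
begin

text \<open>Extension by zero makes the character multiplicative on the whole field, so that the
  Euler product also covers polynomials divisible by \<open>f\<close>. The value of
  \<open>\<psi>\<close> at 0 is unconstrained.\<close>

definition chi0 :: "'b \<Rightarrow> complex" where
  "chi0 x = (if x = 0 then 0 else \<psi> x)"

definition primary_sum :: "nat \<Rightarrow> complex" where
  "primary_sum r = (\<Sum>g\<in>monic_primaries r. of_nat (Lambda g) * chi0 (eval_at \<iota> \<alpha> g))"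

definition monic_sum :: "nat \<Rightarrow> complex" where
  "monic_sum m = (\<Sum>h\<in>monics m. chi0 (eval_at \<iota> \<alpha> h))"

lemma n_pos: "n > 0"
  using degree_irreducible_pos f by blast

lemma chi0_mult: "chi0 (x * y) = chi0 x * chi0 y"
  using chi by (auto simp: chi0_def mult_character_def mult_group_def)

lemma sum_chi0: "(\<Sum>x\<in>UNIV. chi0 x) = 0"
proof -
  obtain x where x: "x \<noteq> 0" "\<psi> x \<noteq> 1" using nontrivial by auto
  have "(\<Sum>y\<in>UNIV. chi0 y) = (\<Sum>y\<in>UNIV. chi0 (x * y))"
    by (rule sum.reindex_bij_witness[of _ "\<lambda>y. x * y" "\<lambda>y. y / x"]) (use x in auto)
  also have "\<dots> = \<psi> x * (\<Sum>y\<in>UNIV. chi0 y)"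
    using x by (simp add: chi0_mult sum_distrib_left) (simp add: chi0_def)
  finally have "(1 - \<psi> x) * (\<Sum>y\<in>UNIV. chi0 y) = 0" by (simp add: algebra_simps)
  thus ?thesis using x by simp
qed

lemma bij_betw_eval_at_small_polys: "bij_betw (eval_at \<iota> \<alpha>) (small_polys n) UNIV"
proof -
  have inj: "inj_on (eval_at \<iota> \<alpha>) (small_polys n)"
  proof (rule inj_onI, rule ccontr)
    fix g h :: "'a poly"
    assume gh: "g \<in> small_polys n" "h \<in> small_polys n" "eval_at \<iota> \<alpha> g = eval_at \<iota> \<alpha> h" "g \<noteq> h"
    have "g - h \<in> small_polys n" using gh by (simp add: small_polys_def)
    hence "degree (g - h) < degree f" using gh(4) f(2) by (simp add: small_polys_iff)
    hence "eval_at \<iota> \<alpha> (g - h) \<noteq> 0" using gh(4) by (intro eval_at_nonzero[OF iota f(1,3)]) auto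
    thus False using gh(3) by (simp add: eval_at_diff[OF iota])
  qed
  have "card (eval_at \<iota> \<alpha> ` small_polys n) = CARD('b)"
    by (simp add: card_image[OF inj] card_small_polys card_b card_a)
  hence "eval_at \<iota> \<alpha> ` small_polys n = UNIV" by (intro card_subset_eq) auto
  thus ?thesis using inj by (simp add: bij_betw_def)
qed

text \<open>Adding a polynomial of degree below \<open>n\<close> permutes the monic polynomials of
  degree \<open>m\<close>. Averaging over all such shifts turns every summand into a complete
  character sum over the field, which vanishes.\<close>

lemma monic_sum_eq_0:
  assumes m: "m \<ge> n"
  shows "monic_sum m = 0"
proof -
  have "monic_sum m = (\<Sum>h\<in>monics m. chi0 (eval_at \<iota> \<alpha> h + eval_at \<iota> \<alpha> c))"
    if c: "c \<in> small_polys n" for c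
  proof -
    have c': "c \<in> small_polys m" "- c \<in> small_polys m" using c m by (auto simp: small_polys_def)
    have shift: "h + e \<in> monics m" if he: "h \<in> monics m" "e \<in> small_polys m" for h e :: "'a poly"
    proof -
      obtain p where "p \<in> small_polys m" "h = monom 1 m + p" using he(1) by (auto simp: monics_eq)
      hence "p + e \<in> small_polys m" "h + e = monom 1 m + (p + e)"
        using he(2) by (auto simp: small_polys_def)
      thus ?thesis unfolding monics_eq by blast
    qed
    have "(\<Sum>h\<in>monics m. chi0 (eval_at \<iota> \<alpha> h)) = (\<Sum>h\<in>monics m. chi0 (eval_at \<iota> \<alpha> (h + c)))"
      by (rule sum.reindex_bij_witness[of _ "\<lambda>h. h + c" "\<lambda>h. h + - c"])
         (use shift[OF _ c'(1)] shift[OF _ c'(2)] in auto)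
    thus ?thesis by (simp add: monic_sum_def eval_at_add[OF iota])
  qed
  hence "(\<Sum>c\<in>(small_polys n :: 'a poly set). monic_sum m) =
      (\<Sum>c\<in>small_polys n. \<Sum>h\<in>monics m. chi0 (eval_at \<iota> \<alpha> h + eval_at \<iota> \<alpha> c))"
    by (rule sum.cong[OF refl])
  also have "\<dots> = (\<Sum>h\<in>monics m. \<Sum>c\<in>small_polys n. chi0 (eval_at \<iota> \<alpha> h + eval_at \<iota> \<alpha> c))"
    by (rule sum.swap)
  also have "\<dots> = (\<Sum>h\<in>(monics m :: 'a poly set). 0)"
  proof (rule sum.cong[OF refl])
    fix h :: "'a poly"
    have "(\<Sum>c\<in>small_polys n. chi0 (eval_at \<iota> \<alpha> h + eval_at \<iota> \<alpha> c)) = (\<Sum>y\<in>UNIV. chi0 (eval_at \<iota> \<alpha> h + y))"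
      by (rule sum.reindex_bij_betw[OF bij_betw_eval_at_small_polys])
    also have "\<dots> = (\<Sum>y\<in>UNIV. chi0 y)"
      by (rule sum.reindex_bij_witness[of _ "\<lambda>y. y - eval_at \<iota> \<alpha> h" "\<lambda>y. eval_at \<iota> \<alpha> h + y"]) auto
    finally show "(\<Sum>c\<in>small_polys n. chi0 (eval_at \<iota> \<alpha> h + eval_at \<iota> \<alpha> c)) = 0"
      by (simp add: sum_chi0)
  qed
  finally have "of_nat (q ^ n) * monic_sum m = 0" by (simp add: card_small_polys card_a)
  moreover have "q > 0" using card_field_gt_1[where 'a = 'a] by (simp add: card_a)
  ultimately show ?thesis by simp
qed

lemma primary_sum_eq_power_sum:
  "\<exists>k w. k < n \<and> (\<forall>r\<ge>1. primary_sum r = - (\<Sum>i<k. w i ^ r))"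
proof (rule newton_identities_power_sums[of monic_sum n primary_sum])
  show "monic_sum 0 = 1"
    by (simp add: monic_sum_def monics_0 eval_at_1[OF iota] chi0_def mult_character_1[OF chi])
  show "of_nat m * monic_sum m = (\<Sum>r=1..m. primary_sum r * monic_sum (m - r))" for m
    unfolding monic_sum_def primary_sum_def
    by (rule euler_product_convolution) (simp add: eval_at_mult[OF iota] chi0_mult)
qed (rule monic_sum_eq_0)

text \<open>With r = 2 t n and m = q^(n t), the bound is of order m = q^(r/2). It combines the upper
  bounds for the weighted number \<open>N y\<close> of polynomials with value \<open>y\<close> and
  the exact total m^2.\<close>

lemma primary_sum_bound_multiples:
  "\<exists>C t0. \<forall>t\<ge>t0. cmod (primary_sum (2 * t * n)) \<le> C * (real q ^ n) ^ t"
proof -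
  \<comment> \<open>In the algebraic closure of the larger field, \<open>\<alpha>\<close> and the
    roots of all polynomials over the smaller field lie together.\<close>
  define j where "j = to_ac \<circ> \<iota>"
  define a where "a = to_ac \<alpha>"
  have j: "field_embedding j" using iota by (simp add: field_embedding_def j_def)
  have ev: "eval_at j a g = to_ac (eval_at \<iota> \<alpha> g)" for g
  proof (induction g)
    case (pCons c g)
    thus ?case
      by (simp add: eval_at_pCons[OF iota] eval_at_pCons[OF j] a_def) (simp add: j_def)
  qed (simp add: eval_at_0)
  interpret finite_field_embedding j q by unfold_locales (simp_all add: j card_a)
  have a1: "a ^ (q ^ n) = a"
    unfolding a_def card_b[symmetric] by (simp add: power_card_eq_self flip: to_ac_power)
  have a2: "\<forall>i\<in>{0<..<n}. a ^ (q ^ i) \<noteq> a"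
    using frobenius_period[of f a] f ev by fastforce
  obtain D where D: "\<forall>t\<ge>2 * D + 7. \<forall>z. z \<noteq> 0 \<longrightarrow>
    finite {b. b ^ (q ^ (2 * t * n)) = b \<and> (\<Prod>i<2 * t * n. a - b ^ (q ^ i)) = z} \<and>
    (q ^ n - 1) * card {b. b ^ (q ^ (2 * t * n)) = b \<and> (\<Prod>i<2 * t * n. a - b ^ (q ^ i)) = z}
      \<le> (q ^ (n * t)) ^ 2 + q ^ (n * t) * (q ^ n - 1) * (2 * D + 3)"
    using card_conjugate_norm_bound[OF j n_pos, of a, folded card_a, OF a1 a2] by (elim exE)
  define s where "s = q ^ n - 1"
  have s: "s > 0" using one_less_power[OF q_gt_1 n_pos] by (simp add: s_def)
  show ?thesis
  proof (intro exI[of _ "real s * (2 * real D + 3) + real n"] exI[of _ "2 * D + 7"] allI impI)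
    fix t assume t: "t \<ge> 2 * D + 7"
    define r where "r = 2 * t * n"
    define m where "m = q ^ (n * t)"
    have m2: "m ^ 2 = q ^ r" by (simp add: m_def r_def mult_ac flip: power_mult)
    have m1: "m \<ge> 1" by (simp add: m_def Suc_le_eq)
    define A where "A = (\<lambda>z. {b. b ^ (q ^ r) = b \<and> (\<Prod>i<r. a - b ^ (q ^ i)) = z})"
    define N where "N = (\<lambda>y. \<Sum>g | g \<in> monic_primaries r \<and> eval_at \<iota> \<alpha> g = y. Lambda g)"
    have NA: "N y \<le> card (A (to_ac y))" if "finite (A (to_ac y))" for y
      using sum_Lambda_le_card_conjugate_norm[OF j, of r a "to_ac y"] that
      unfolding N_def A_def card_a ev by simp
    \<comment> \<open>The counting bound excludes the value 0. There some factor a - b^(q^i)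
      vanishes, which makes b one of at most \<open>n\<close> conjugates of a.\<close>
    have N0: "N 0 \<le> n"
    proof -
      have "A 0 \<subseteq> (\<lambda>l. a ^ (q ^ l)) ` {..<n}"
      proof
        fix b assume "b \<in> A 0"
        then obtain i where b: "b ^ (q ^ r) = b" "i < r" "b ^ (q ^ i) = a" by (auto simp: A_def)
        have "b = b ^ (q ^ (i + (r - i)))" using b by simp
        also have "\<dots> = a ^ (q ^ (r - i))" by (simp only: power_add power_mult b(3))
        also have "r - i = n * ((r - i) div n) + (r - i) mod n" by simp
        also have "a ^ (q ^ \<dots>) = a ^ (q ^ ((r - i) mod n))"
          by (simp only: power_add power_mult) (simp only: frobenius_iterate[OF a1] flip: power_mult)
        finally show "b \<in> (\<lambda>l. a ^ (q ^ l)) ` {..<n}" using n_pos by auto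
      qed
      from finite_subset[OF this] card_mono[OF _ this] card_image_le[of "{..<n}" "\<lambda>l. a ^ (q ^ l)"]
      show ?thesis using NA[of 0] by simp
    qed
    have Ny: "s * N y \<le> m ^ 2 + m * s * (2 * D + 3)" if "y \<noteq> 0" for y
    proof -
      have "finite (A (to_ac y))" "s * card (A (to_ac y)) \<le> m ^ 2 + m * s * (2 * D + 3)"
        using D[rule_format, OF t, of "to_ac y"] that unfolding A_def r_def m_def s_def by simp_all
      thus ?thesis using mult_le_mono2[OF NA, of y s] by linarith
    qed
    have total: "(\<Sum>y\<in>UNIV. N y) = m ^ 2"
    proof -
      have "(\<Sum>y\<in>UNIV. N y) = (\<Sum>g\<in>(monic_primaries r :: 'a poly set). Lambda g)"
        unfolding N_def by (rule sum.group) (auto simp: finite_monic_primaries)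
      also have "\<dots> = m ^ 2"
        unfolding m2 card_a using t n_pos by (intro sum_Lambda_monic_primaries) (auto simp: r_def)
      finally show ?thesis .
    qed
    have S: "primary_sum r = (\<Sum>y\<in>UNIV. of_nat (N y) * chi0 y)"
    proof -
      have "primary_sum r = (\<Sum>y\<in>UNIV. \<Sum>g | g \<in> monic_primaries r \<and> eval_at \<iota> \<alpha> g = y.
          of_nat (Lambda g) * chi0 (eval_at \<iota> \<alpha> g))"
        unfolding primary_sum_def by (rule sum.group[symmetric]) (auto simp: finite_monic_primaries)
      also have "\<dots> = (\<Sum>y\<in>UNIV. of_nat (N y) * chi0 y)"
        by (intro sum.cong refl) (auto simp: N_def sum_distrib_right)
      finally show ?thesis .
    qed
    text \<open>Subtracting the common upper bound \<open>B\<close> from all \<open>N y\<close> leaves the sum unchanged and makes all its weights of one sign.\<close>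
    define B where "B = (real m ^ 2 + real m * real s * (2 * real D + 3)) / real s"
    have NB: "real (N y) \<le> B" if "y \<noteq> 0" for y
    proof -
      have "real (s * N y) \<le> real (m ^ 2 + m * s * (2 * D + 3))" using Ny[OF that] of_nat_le_iff by blast
      thus ?thesis using s by (simp add: B_def field_simps)
    qed
    have card: "card (UNIV - {0 :: 'b}) = s" by (simp add: card_Diff_subset card_b s_def)
    have "primary_sum r = (\<Sum>y\<in>UNIV. (of_nat (N y) - of_real B) * chi0 y)"
      unfolding S using sum_chi0 by (simp add: left_diff_distrib sum_subtractf flip: sum_distrib_left)
    also have "\<dots> = (\<Sum>y\<in>UNIV - {0}. (of_nat (N y) - of_real B) * chi0 y)"
      by (rule sum.mono_neutral_right) (auto simp: chi0_def)
    also have "cmod \<dots> \<le> (\<Sum>y\<in>UNIV - {0}. B - real (N y))"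
    proof (rule sum_norm_le)
      fix y :: 'b assume y: "y \<in> UNIV - {0}"
      have "cmod (of_nat (N y) - of_real B) = \<bar>real (N y) - B\<bar>"
        by (metis norm_of_real of_real_diff of_real_of_nat_eq)
      thus "cmod ((of_nat (N y) - of_real B) * chi0 y) \<le> B - real (N y)"
        using y NB[of y] norm_mult_character[OF chi, of y] by (simp add: norm_mult chi0_def)
    qed
    also have "\<dots> = real s * B - (\<Sum>y\<in>UNIV - {0}. real (N y))"
      by (simp add: sum_subtractf card)
    also have "(\<Sum>y\<in>UNIV - {0}. real (N y)) = real m ^ 2 - real (N 0)"
    proof -
      have "real (\<Sum>y\<in>UNIV. N y) = real (N 0) + (\<Sum>y\<in>UNIV - {0}. real (N y))"
        unfolding of_nat_sum by (rule sum.remove) auto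
      thus ?thesis using total by simp
    qed
    \<comment> \<open>The main term m^2 of \<open>s * B\<close> cancels against the total weight;
      what remains is of order m, apart from \<open>N 0\<close>, which is at most
      \<open>n\<close>.\<close>
    also have "real s * B - (real m ^ 2 - real (N 0)) \<le> (real s * (2 * real D + 3) + real n) * real m"
      using s N0 m1 mult_left_mono[of 1 "real m" "real n"] by (simp add: B_def algebra_simps)
    also have "real m = (real q ^ n) ^ t" by (simp add: m_def power_mult)
    finally show "cmod (primary_sum (2 * t * n)) \<le> (real s * (2 * real D + 3) + real n) * (real q ^ n) ^ t"
      by (simp only: r_def)
  qed
qed

text \<open>The estimate along multiples of 2n bounds every inverse root of the L-function by the
  square root of q. The power sum formula then gives the bound for all r, with fewer than
  \<open>n\<close> terms.\<close>

lemma primary_sum_weil_bound: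
  assumes "r \<ge> 1"
  shows "cmod (primary_sum r) \<le> (real n - 1) * real q powr (real r / 2)"
proof -
  obtain k w where k: "k < n" and w: "\<forall>r\<ge>1. primary_sum r = - (\<Sum>i<k. w i ^ r)"
    using primary_sum_eq_power_sum by (elim exE conjE)
  obtain C t0 where C: "\<forall>t\<ge>t0. cmod (primary_sum (2 * t * n)) \<le> C * (real q ^ n) ^ t"
    using primary_sum_bound_multiples by (elim exE)
  have q: "q > 0" using card_field_gt_1[where 'a = 'a] by (simp add: card_a)
  have wi: "cmod (w i) \<le> sqrt (real q)" if i: "i < k" for i
  proof -
    \<comment> \<open>The growth lemma is applied to the powers \<open>w i ^ (2 * n)\<close>. The
      threshold \<open>max 1 t0\<close> keeps the index 2 t n positive, where the power sum formula
      holds.\<close>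
    have "cmod (w i ^ (2 * n)) \<le> real q ^ n"
    proof (rule power_sum_growth_bound[of "real q ^ n" "max 1 t0" "\<lambda>i. w i ^ (2 * n)" k C i])
      fix t assume t: "t \<ge> max 1 t0"
      have "(\<Sum>i<k. (w i ^ (2 * n)) ^ t) = - primary_sum (2 * t * n)"
      proof -
        have "2 * t * n \<ge> 1" using t n_pos by simp
        moreover have "2 * n * t = 2 * t * n" by simp
        ultimately show ?thesis using w by (simp only: minus_minus flip: power_mult)
      qed
      thus "cmod (\<Sum>i<k. (w i ^ (2 * n)) ^ t) \<le> C * (real q ^ n) ^ t" using C t by simp
    qed (use q i in auto)
    also have "real q ^ n = sqrt (real q) ^ (2 * n)" by (simp add: power_mult)
    finally have "cmod (w i) ^ (2 * n) \<le> sqrt (real q) ^ (2 * n)" by (simp add: norm_power)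
    thus ?thesis using power_mono_iff[of "cmod (w i)" "sqrt (real q)" "2 * n"] n_pos by simp
  qed
  have "cmod (primary_sum r) = cmod (\<Sum>i<k. w i ^ r)" using w assms by simp
  also have "\<dots> \<le> (\<Sum>i<k. sqrt (real q) ^ r)"
    by (intro sum_norm_le) (use wi in \<open>auto simp: norm_power intro!: power_mono\<close>)
  also have "\<dots> = real k * sqrt (real q) ^ r" by simp
  also have "sqrt (real q) ^ r = sqrt (real q) powr real r"
    using q by (intro powr_realpow[symmetric]) simp
  also have "\<dots> = (real q powr (1 / 2)) powr real r" by (simp add: powr_half_sqrt)
  also have "\<dots> = real q powr (real r / 2)" unfolding powr_powr by simp
  also have "real k * real q powr (real r / 2) \<le> (real n - 1) * real q powr (real r / 2)"
    using k by (intro mult_right_mono) auto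
  finally show ?thesis .
qed

end

section \<open>Fourier analysis and the spectral gap\<close>

lemma mult_group_cyclic:
  "\<exists>\<gamma> :: 'b::{field,finite}. \<gamma> \<noteq> 0 \<and> (\<forall>x. x \<noteq> 0 \<longrightarrow> (\<exists>k. x = \<gamma> ^ k))"
proof -
  define R where "R = (ring_of_type_algebra :: 'b ring)"
  interpret R: Ring.field R unfolding R_def by (rule field_from_type_algebra)
  have carrier: "carrier (Multiplicative_Group.mult_of R) = UNIV - {0}"
    by (simp add: mult_of_def R_def ring_of_type_algebra_def)
  have pow: "x [^]\<^bsub>R\<^esub> (k :: nat) = x ^ k" for x k
  proof (induction k)
    case 0
    have "\<one>\<^bsub>R\<^esub> = 1" by (simp add: R_def ring_of_type_algebra_def)
    thus ?case by simp
  next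
    case (Suc k)
    have "y \<otimes>\<^bsub>R\<^esub> x = y * x" for y by (simp add: R_def ring_of_type_algebra_def)
    thus ?case using Suc by (simp add: mult.commute)
  qed
  have fin: "finite (carrier R)" by (simp add: R_def ring_of_type_algebra_def)
  obtain \<gamma> where \<gamma>: "\<gamma> \<in> carrier (Multiplicative_Group.mult_of R)"
    "carrier (Multiplicative_Group.mult_of R) = {\<gamma> [^]\<^bsub>R\<^esub> i | i :: nat. i \<in> UNIV}"
    using R.finite_field_mult_group_has_gen[OF fin] by (elim bexE)
  show ?thesis
  proof (intro exI[of _ \<gamma>] conjI allI impI)
    show "\<gamma> \<noteq> 0" using \<gamma>(1) unfolding carrier by simp
    fix x :: 'b assume "x \<noteq> 0"
    hence "x \<in> {\<gamma> [^]\<^bsub>R\<^esub> i | i :: nat. i \<in> UNIV}" unfolding \<gamma>(2)[symmetric] carrier by simp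
    then obtain k :: nat where "x = \<gamma> [^]\<^bsub>R\<^esub> k" by blast
    thus "\<exists>k. x = \<gamma> ^ k" unfolding pow by blast
  qed
qed

text \<open>A generator is sent to a primitive root of unity of the group order, by way of the
  discrete logarithm \<open>L\<close>. The powers of this one character suffice for Fourier
  inversion.\<close>

lemma faithful_character_exists:
  obtains e :: "'b::{field,finite} \<Rightarrow> complex" where "mult_character e" "inj_on e mult_group"
proof -
  obtain \<gamma> :: 'b where \<gamma>: "\<gamma> \<noteq> 0" "\<forall>x. x \<noteq> 0 \<longrightarrow> (\<exists>k. x = \<gamma> ^ k)"
    using mult_group_cyclic by blast
  define s where "s = CARD('b) - 1"
  have s: "s > 0" using card_field_gt_1[where 'a = 'b] by (simp add: s_def)
  have \<gamma>_mod: "\<gamma> ^ (k mod s) = \<gamma> ^ k" for k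
  proof -
    have "\<gamma> ^ k = \<gamma> ^ (s * (k div s) + k mod s)" by simp
    also have "\<dots> = \<gamma> ^ (k mod s)"
      using power_card_minus_1[OF \<gamma>(1)] unfolding power_add power_mult s_def by simp
    finally show ?thesis ..
  qed
  have img: "(\<lambda>k. \<gamma> ^ k) ` {..<s} = UNIV - {0}"
  proof (intro equalityI subsetI)
    fix x assume "x \<in> UNIV - {0 :: 'b}"
    then obtain k where "x = \<gamma> ^ k" using \<gamma>(2) by auto
    thus "x \<in> (\<lambda>k. \<gamma> ^ k) ` {..<s}" using s by (intro image_eqI[of _ _ "k mod s"]) (auto simp: \<gamma>_mod)
  qed (use \<gamma>(1) in auto)
  have inj: "inj_on (\<lambda>k. \<gamma> ^ k) {..<s}"
  proof (rule eq_card_imp_inj_on)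
    have "card (UNIV - {0 :: 'b}) = card {..<s}" by (simp add: card_Diff_subset s_def)
    thus "card ((\<lambda>k. \<gamma> ^ k) ` {..<s}) = card {..<s}" by (simp only: img)
  qed simp
  define L where "L = the_inv_into {..<s} (\<lambda>k. \<gamma> ^ k)"
  have L: "L x < s" "\<gamma> ^ L x = x" if "x \<noteq> 0" for x
    using the_inv_into_into[OF inj, of x "{..<s}"] f_the_inv_into_f[OF inj, of x] that img
    by (auto simp: L_def)
  define \<omega> where "\<omega> = cis (2 * pi / real s)"
  have \<omega>: "\<omega> ^ k = cis (2 * pi * real k / real s)" for k
    by (simp add: \<omega>_def Complex.DeMoivre mult_ac)
  have \<omega>_s: "\<omega> ^ s = 1" using s by (simp add: \<omega>)
  have \<omega>_mod: "\<omega> ^ (k mod s) = \<omega> ^ k" for k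
  proof -
    have "\<omega> ^ k = \<omega> ^ (s * (k div s) + k mod s)" by simp
    also have "\<dots> = \<omega> ^ (k mod s)" unfolding power_add power_mult \<omega>_s by simp
    finally show ?thesis ..
  qed
  show ?thesis
  proof (rule that[of "\<lambda>x. \<omega> ^ L x"])
    show "inj_on (\<lambda>x. \<omega> ^ L x) mult_group"
    proof (rule inj_onI)
      fix x y :: 'b assume "x \<in> mult_group" "y \<in> mult_group" and eq: "\<omega> ^ L x = \<omega> ^ L y"
      hence xy: "x \<noteq> 0" "y \<noteq> 0" by (auto simp: mult_group_def)
      have "inj_on (\<lambda>k. cis (2 * pi * real k / real s)) {..<s}"
        using Complex.bij_betw_roots_unity[OF s] by (rule bij_betw_imp_inj_on)
      hence "L x = L y" using eq L(1)[OF xy(1)] L(1)[OF xy(2)] unfolding \<omega> by (auto dest: inj_onD)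
      thus "x = y" using L(2)[OF xy(1)] L(2)[OF xy(2)] by metis
    qed
    have "\<omega> ^ L (x * y) = \<omega> ^ L x * \<omega> ^ L y" if xy: "x \<noteq> 0" "y \<noteq> 0" for x y
    proof -
      have "\<gamma> ^ ((L x + L y) mod s) = \<gamma> ^ L (x * y)"
        using L(2) xy by (simp add: \<gamma>_mod power_add)
      hence "(L x + L y) mod s = L (x * y)" using inj_onD[OF inj] L(1)[of "x * y"] xy s by auto
      hence "\<omega> ^ L (x * y) = \<omega> ^ ((L x + L y) mod s)" by simp
      thus ?thesis by (simp only: \<omega>_mod power_add)
    qed
    thus "mult_character (\<lambda>x. \<omega> ^ L x)"
      by (auto simp: mult_character_def mult_group_def \<omega>_def)
  qed
qed

text \<open>Fourier inversion at \<open>x\<close>: for a faithful e, the geometric sum of the powers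
  of e(y) / e(x) vanishes unless y = x. If all coefficients were zero, so would be the group order
  times \<open>h x\<close>.\<close>

lemma fourier_coefficient_nonzero:
  fixes h :: "'b::{field,finite} \<Rightarrow> complex"
  assumes h: "x \<in> mult_group" "h x \<noteq> 0"
  shows "\<exists>\<psi>. mult_character \<psi> \<and> (\<Sum>y\<in>mult_group. \<psi> y * h y) \<noteq> 0"
proof (rule ccontr)
  assume "\<not> ?thesis"
  hence zero: "(\<Sum>y\<in>mult_group. \<psi> y * h y) = 0" if "mult_character \<psi>" for \<psi>
    using that by blast
  obtain e :: "'b \<Rightarrow> complex" where e: "mult_character e" "inj_on e mult_group"
    by (rule faithful_character_exists)
  define s where "s = CARD('b) - 1"
  have s: "s > 0" using card_field_gt_1[where 'a = 'b] by (simp add: s_def)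
  have nz: "e y \<noteq> 0" "e y ^ s = 1" if "y \<in> mult_group" for y
    using that e(1) mult_character_power[OF e(1), of y s] power_card_minus_1[of y]
    by (auto simp: mult_character_def mult_group_def s_def mult_character_1[OF e(1)] simp del: One_nat_def)
  have chars: "mult_character (\<lambda>y. e y ^ k)" for k
    using e(1) by (auto simp: mult_character_def power_mult_distrib)
  have geom: "(\<Sum>k<s. (e y / e x) ^ k) = (if y = x then of_nat s else 0)" if y: "y \<in> mult_group" for y
  proof (cases "y = x")
    case True
    thus ?thesis using nz[OF h(1)] by simp
  next
    case False
    hence "e y / e x \<noteq> 1" using e(2) y h(1) nz[OF h(1)] by (auto dest: inj_onD)
    moreover have "(e y / e x) ^ s = 1" using nz(2)[OF y] nz(2)[OF h(1)] by (simp add: power_divide)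
    ultimately show ?thesis using False unfolding sum_gp_strict by (simp only: if_False) simp
  qed
  have "0 = (\<Sum>k<s. inverse (e x) ^ k * (\<Sum>y\<in>mult_group. e y ^ k * h y))"
    using zero[OF chars] by simp
  also have "\<dots> = (\<Sum>k<s. \<Sum>y\<in>mult_group. (e y / e x) ^ k * h y)"
    by (simp add: sum_distrib_left power_divide divide_inverse power_inverse mult_ac power_mult_distrib)
  also have "\<dots> = (\<Sum>y\<in>mult_group. \<Sum>k<s. (e y / e x) ^ k * h y)" by (rule sum.swap)
  also have "\<dots> = (\<Sum>y\<in>mult_group. if y = x then of_nat s * h x else 0)"
    by (intro sum.cong refl) (auto simp: geom simp flip: sum_distrib_right)
  also have "\<dots> = of_nat s * h x" using h(1) by simp
  finally show False using h(2) s by simp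
qed

text \<open>Below degree \<open>n\<close> no monic primary polynomial vanishes at
  \<open>\<alpha>\<close>, so extension by zero does not alter the sum.\<close>

lemma S_sum_bound:
  fixes \<iota> :: "'a::{field,finite} \<Rightarrow> 'b::{field,finite}"
  assumes "field_embedding \<iota>" "CARD('b) = CARD('a) ^ n" "irreducible f" "degree f = n"
    "eval_at \<iota> \<alpha> f = 0" "mult_character \<psi>" "x \<noteq> 0" "\<psi> x \<noteq> 1" "1 \<le> d" "d < n"
  shows "cmod (S_sum \<iota> \<alpha> d \<psi>) \<le> (real n - 1) * real CARD('a) powr (real d / 2)"
proof -
  interpret nontrivial_character_sum \<iota> \<alpha> f n "CARD('a)" \<psi>
    by unfold_locales (use assms in auto)
  have "S_sum \<iota> \<alpha> d \<psi> = primary_sum d"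
    unfolding S_sum_def primary_sum_def
    using eval_at_monic_primaries_nonzero[OF assms(1,3,5)] assms(4,10)
    by (intro sum.cong) (auto simp: chi0_def)
  thus ?thesis using primary_sum_weil_bound[OF assms(9)] by simp
qed

section \<open>The weighted graph and its mean-zero spectrum\<close>

lemma Lambda_monic_primaries_pos: "g \<in> monic_primaries d \<Longrightarrow> Lambda g > 0"
  by (auto simp: monic_primaries_def elim!: monic_primaryE dest: degree_irreducible_pos)

lemma Gd_weight_eq:
  assumes "field_embedding \<iota>" "irreducible f" "eval_at \<iota> \<alpha> f = 0" "d < degree f"
    and "g \<in> monic_primaries d" "y / x = eval_at \<iota> \<alpha> g"
  shows "Gd_weight \<iota> \<alpha> d (x, y) = real (Lambda g)"
proof -
  have "(THE g'. g' \<in> monic_primaries d \<and> eval_at \<iota> \<alpha> g = eval_at \<iota> \<alpha> g') = g"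
    using assms(5) inj_on_eval_at_monic_primaries[OF assms(1-4)]
    by (intro the_equality) (auto dest: inj_onD)
  thus ?thesis using assms(6) by (simp add: Gd_weight_def)
qed

text \<open>Out-neighbours arise by multiplication with the values of the primary polynomials and
  in-neighbours by division. Both weights add up to the sum of \<open>Lambda\<close>, which is
  q^d.\<close>

lemma Gd_graph_weighted_regular:
  fixes \<iota> :: "'a::{field,finite} \<Rightarrow> 'b::{field,finite}"
  assumes emb: "field_embedding \<iota>" "irreducible f" "eval_at \<iota> \<alpha> f = 0" "d < degree f" and d: "1 \<le> d"
  shows "weighted_regular (Gd_graph \<iota> \<alpha> d) (Gd_weight \<iota> \<alpha> d) (real CARD('a) ^ d)"
  unfolding weighted_regular_def
proof (intro ballI conjI)
  fix x assume "x \<in> pverts (Gd_graph \<iota> \<alpha> d)"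
  hence x: "x \<noteq> 0" by (simp add: Gd_graph_def mult_group_def)
  let ?P = "monic_primaries d :: 'a poly set"
  note ev0 = eval_at_monic_primaries_nonzero[OF emb]
  note inj = inj_on_eval_at_monic_primaries[OF emb]
  have total: "(\<Sum>g\<in>?P. real (Lambda g)) = real CARD('a) ^ d"
    by (simp add: sum_Lambda_monic_primaries[OF d] flip: of_nat_sum)
  have "{y. (x, y) \<in> parcs (Gd_graph \<iota> \<alpha> d)} = (\<lambda>g. x * eval_at \<iota> \<alpha> g) ` ?P"
    using x ev0 by (auto simp: Gd_graph_def mult_group_def field_simps image_iff)
  moreover have "inj_on (\<lambda>g. x * eval_at \<iota> \<alpha> g) ?P" using inj x by (auto simp: inj_on_def)
  ultimately have "(\<Sum>y | (x, y) \<in> parcs (Gd_graph \<iota> \<alpha> d). Gd_weight \<iota> \<alpha> d (x, y)) =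
      (\<Sum>g\<in>?P. Gd_weight \<iota> \<alpha> d (x, x * eval_at \<iota> \<alpha> g))"
    by (simp add: sum.reindex)
  also have "\<dots> = (\<Sum>g\<in>?P. real (Lambda g))"
    using x by (intro sum.cong refl Gd_weight_eq[OF emb]) auto
  finally show "(\<Sum>y | (x, y) \<in> parcs (Gd_graph \<iota> \<alpha> d). Gd_weight \<iota> \<alpha> d (x, y)) = real CARD('a) ^ d"
    by (simp only: total)
  have "{y. (y, x) \<in> parcs (Gd_graph \<iota> \<alpha> d)} = (\<lambda>g. x / eval_at \<iota> \<alpha> g) ` ?P"
    using x ev0 by (auto simp: Gd_graph_def mult_group_def field_simps image_iff)
  moreover have "inj_on (\<lambda>g. x / eval_at \<iota> \<alpha> g) ?P"
    using inj x ev0 by (auto simp: inj_on_def)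
  ultimately have "(\<Sum>y | (y, x) \<in> parcs (Gd_graph \<iota> \<alpha> d). Gd_weight \<iota> \<alpha> d (y, x)) =
      (\<Sum>g\<in>?P. Gd_weight \<iota> \<alpha> d (x / eval_at \<iota> \<alpha> g, x))"
    by (simp add: sum.reindex)
  also have "\<dots> = (\<Sum>g\<in>?P. real (Lambda g))"
    using x ev0 by (intro sum.cong refl Gd_weight_eq[OF emb]) auto
  finally show "(\<Sum>y | (y, x) \<in> parcs (Gd_graph \<iota> \<alpha> d). Gd_weight \<iota> \<alpha> d (y, x)) = real CARD('a) ^ d"
    by (simp only: total)
qed

text \<open>The eigenfunction is paired with a character \<open>\<phi>\<close> at which its Fourier
  coefficient is non-zero; mean zero rules out the trivial one. Moving the translations in
  \<open>M_star\<close> from \<open>h\<close> to \<open>\<phi>\<close> produces the inverse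
  character \<open>\<psi>\<close>, and the coefficient cancels.\<close>

lemma mean_zero_eigenvalue_eq_S_sum:
  fixes \<iota> :: "'a::{field,finite} \<Rightarrow> 'b::{field,finite}"
  assumes emb: "field_embedding \<iota>" "irreducible f" "eval_at \<iota> \<alpha> f = 0" "d < degree f"
    and eig: "is_eigenvector mult_group (M_star \<iota> \<alpha> d) h l" and mean: "(\<Sum>x\<in>mult_group. h x) = 0"
  shows "\<exists>\<psi> x. mult_character \<psi> \<and> x \<noteq> 0 \<and> \<psi> x \<noteq> 1 \<and> l = S_sum \<iota> \<alpha> d \<psi>"
proof -
  obtain x0 where "x0 \<in> mult_group" "h x0 \<noteq> 0" using eig by (auto simp: is_eigenvector_def)
  then obtain \<phi> where \<phi>: "mult_character \<phi>" "(\<Sum>y\<in>mult_group. \<phi> y * h y) \<noteq> 0"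
    using fourier_coefficient_nonzero by blast
  define \<psi> where "\<psi> = (\<lambda>x. inverse (\<phi> x))"
  have \<psi>: "mult_character \<psi>" using \<phi>(1) by (auto simp: mult_character_def \<psi>_def)
  have "\<exists>x\<in>mult_group. \<phi> x \<noteq> 1"
  proof (rule ccontr)
    assume "\<not> ?thesis"
    hence "(\<Sum>y\<in>mult_group. \<phi> y * h y) = (\<Sum>y\<in>mult_group. h y)" by (intro sum.cong) auto
    thus False using \<phi>(2) mean by simp
  qed
  then obtain x where x: "x \<noteq> 0" "\<phi> x \<noteq> 1" by (auto simp: mult_group_def)
  let ?F = "\<Sum>y\<in>mult_group. \<phi> y * h y"
  have "l * ?F = (\<Sum>y\<in>mult_group. \<phi> y * M_star \<iota> \<alpha> d h y)"
    using eig by (auto simp: is_eigenvector_def sum_distrib_left mult_ac intro!: sum.cong)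
  also have "\<dots> = (\<Sum>y\<in>mult_group. \<Sum>g\<in>monic_primaries d.
      of_nat (Lambda g) * (\<phi> y * h (y * eval_at \<iota> \<alpha> g)))"
    by (simp add: M_star_def sum_distrib_left mult_ac)
  also have "\<dots> = (\<Sum>g\<in>monic_primaries d. \<Sum>y\<in>mult_group.
      of_nat (Lambda g) * (\<phi> y * h (y * eval_at \<iota> \<alpha> g)))"
    by (rule sum.swap)
  also have "\<dots> = (\<Sum>g\<in>monic_primaries d. of_nat (Lambda g) * (\<psi> (eval_at \<iota> \<alpha> g) * ?F))"
  proof (rule sum.cong[OF refl])
    fix g :: "'a poly" assume "g \<in> monic_primaries d"
    hence ev: "eval_at \<iota> \<alpha> g \<noteq> 0" by (rule eval_at_monic_primaries_nonzero[OF emb])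
    have "(\<Sum>y\<in>mult_group. \<phi> y * h (y * eval_at \<iota> \<alpha> g)) = (\<Sum>y\<in>mult_group. \<psi> (eval_at \<iota> \<alpha> g) * (\<phi> y * h y))"
    proof (rule sum.reindex_bij_witness[of _ "\<lambda>y. y / eval_at \<iota> \<alpha> g" "\<lambda>y. y * eval_at \<iota> \<alpha> g"])
      fix y :: 'b assume "y \<in> mult_group"
      thus "\<psi> (eval_at \<iota> \<alpha> g) * (\<phi> (y * eval_at \<iota> \<alpha> g) * h (y * eval_at \<iota> \<alpha> g)) =
          \<phi> y * h (y * eval_at \<iota> \<alpha> g)"
        using ev \<phi>(1) by (auto simp: mult_character_def mult_group_def \<psi>_def)
    qed (use ev in \<open>auto simp: mult_group_def\<close>)
    thus "(\<Sum>y\<in>mult_group. of_nat (Lambda g) * (\<phi> y * h (y * eval_at \<iota> \<alpha> g))) =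
        of_nat (Lambda g) * (\<psi> (eval_at \<iota> \<alpha> g) * ?F)"
      by (simp flip: sum_distrib_left)
  qed
  also have "\<dots> = S_sum \<iota> \<alpha> d \<psi> * ?F"
    by (simp add: S_sum_def sum_distrib_right mult.assoc)
  finally have "l = S_sum \<iota> \<alpha> d \<psi>" using \<phi>(2) by simp
  moreover have "\<psi> x \<noteq> 1" using x by (simp add: \<psi>_def)
  ultimately show ?thesis using \<psi> x(1) by blast
qed

lemma H_subgroup_subset_mult_group:
  assumes "field_embedding \<iota>" "irreducible f" "eval_at \<iota> \<alpha> f = 0" "d < degree f"
  shows "H_subgroup \<iota> \<alpha> d \<subseteq> mult_group"
  unfolding H_subgroup_def
proof (rule hull_minimal)
  show "eval_at \<iota> \<alpha> ` monic_primaries d \<subseteq> mult_group"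
    using eval_at_monic_primaries_nonzero[OF assms] by (auto simp: mult_group_def)
qed (auto simp: mult_subgroup_def mult_group_def)

theorem theorem19:
  fixes \<iota> :: "'a::{field,finite} \<Rightarrow> 'b::{field,finite}"
    and \<alpha> :: 'b and f :: "'a poly" and q n d :: nat and \<delta> :: real
  assumes "field_embedding \<iota>"
    and "card (UNIV :: 'a set) = q" and "card (UNIV :: 'b set) = q ^ n"
    and "n > 1" and "1 \<le> d" and "d < n"
    and "irreducible f" and "degree f = n" and "eval_at \<iota> \<alpha> f = 0"
    and "0 < \<delta>" and "\<delta> < 1"
    and "real n - 1 \<le> real q powr (real d / 2) * (1 - \<delta>)"
  shows "(\<forall>l. nontrivial_eigenvalue \<iota> \<alpha> d l \<longrightarrow> cmod l \<le> real q ^ d * (1 - \<delta>)) \<and>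
         expander_graph (Gd_graph \<iota> \<alpha> d) (Gd_weight \<iota> \<alpha> d) (real q ^ d) \<delta>"
proof -
  have emb: "field_embedding \<iota>" "irreducible f" "eval_at \<iota> \<alpha> f = 0" "d < degree f"
    using assms by auto
  have q: "q > 1" using card_field_gt_1[where 'a = 'a] assms(2) by simp
  \<comment> \<open>One bound for all characters non-trivial on the whole group serves both claims,
    as non-triviality on the subgroup H implies it. The hypothesis absorbs n - 1 into one factor
    q^(d/2), and the Weil bound supplies the other.\<close>
  have bound: "cmod (S_sum \<iota> \<alpha> d \<psi>) \<le> real q ^ d * (1 - \<delta>)"
    if \<psi>: "mult_character \<psi>" "x \<noteq> 0" "\<psi> x \<noteq> 1" for \<psi> x
  proof -
    have "cmod (S_sum \<iota> \<alpha> d \<psi>) \<le> (real n - 1) * real q powr (real d / 2)"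
      using S_sum_bound[OF assms(1) _ assms(7,8,9) \<psi> assms(5,6)] assms(2,3) by simp
    also have "\<dots> \<le> (real q powr (real d / 2) * (1 - \<delta>)) * real q powr (real d / 2)"
      by (intro mult_right_mono assms(12)) simp
    also have "\<dots> = (real q powr (real d / 2) * real q powr (real d / 2)) * (1 - \<delta>)"
      by (simp only: mult_ac)
    also have "real q powr (real d / 2) * real q powr (real d / 2) = real q ^ d"
      using q by (simp add: powr_realpow flip: powr_add)
    finally show ?thesis .
  qed
  have "cmod l \<le> real q ^ d * (1 - \<delta>)" if l: "nontrivial_eigenvalue \<iota> \<alpha> d l" for l
  proof -
    obtain \<psi> x where "mult_character \<psi>" "x \<in> H_subgroup \<iota> \<alpha> d" "\<psi> x \<noteq> 1" "l = S_sum \<iota> \<alpha> d \<psi>"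
      using l unfolding nontrivial_eigenvalue_iff[OF emb] by blast
    thus ?thesis using bound H_subgroup_subset_mult_group[OF emb] by (auto simp: mult_group_def)
  qed
  moreover have "expander_graph (Gd_graph \<iota> \<alpha> d) (Gd_weight \<iota> \<alpha> d) (real q ^ d) \<delta>"
    unfolding expander_graph_def
  proof (intro conjI ballI allI impI)
    show "pair_fin_digraph (Gd_graph \<iota> \<alpha> d)"
      by unfold_locales (auto simp: Gd_graph_def)
    show "pverts (Gd_graph \<iota> \<alpha> d) \<noteq> {}"
    proof -
      have "1 \<in> pverts (Gd_graph \<iota> \<alpha> d)" by (simp add: Gd_graph_def mult_group_def)
      thus ?thesis by blast
    qed
    show "Gd_weight \<iota> \<alpha> d e > 0" if e: "e \<in> parcs (Gd_graph \<iota> \<alpha> d)" for e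
    proof -
      obtain x y where xy: "e = (x, y)" by (cases e)
      then obtain g where "g \<in> monic_primaries d" "y / x = eval_at \<iota> \<alpha> g"
        using e by (auto simp: Gd_graph_def)
      thus ?thesis using Gd_weight_eq[OF emb, of g y x] Lambda_monic_primaries_pos[of g d] xy by simp
    qed
    show "weighted_regular (Gd_graph \<iota> \<alpha> d) (Gd_weight \<iota> \<alpha> d) (real q ^ d)"
      using Gd_graph_weighted_regular[OF emb assms(5)] assms(2) by simp
    show "real q ^ d > 0" using q by simp
    show "\<delta> > 0" by (rule assms)
    fix h l
    assume *: "is_eigenvector (pverts (Gd_graph \<iota> \<alpha> d))
        (weighted_adjacency (Gd_graph \<iota> \<alpha> d) (Gd_weight \<iota> \<alpha> d)) h l \<and>
      (\<Sum>x\<in>pverts (Gd_graph \<iota> \<alpha> d). h x) = 0"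
    have V: "pverts (Gd_graph \<iota> \<alpha> d) = mult_group" by (simp add: Gd_graph_def)
    have "is_eigenvector mult_group (M_star \<iota> \<alpha> d) h l"
      using * by (simp add: is_eigenvector_def V weighted_adjacency_Gd_graph[OF emb])
    then obtain \<psi> x where "mult_character \<psi>" "x \<noteq> 0" "\<psi> x \<noteq> 1" "l = S_sum \<iota> \<alpha> d \<psi>"
      using mean_zero_eigenvalue_eq_S_sum[OF emb, of h l] * unfolding V by blast
    thus "cmod l \<le> real q ^ d * (1 - \<delta>)" using bound by blast
  qed
  ultimately show ?thesis by blast
qed

end
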